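(* Let $k$ be a field, let $G$ be a group acting on a tree $X$ with vertex set $V$, and let $\mathscr{S}$ be a $G$-equivariant sheaf of $k$-vector spaces on $X$. Assume that the cardinal number $$\mathrm{Rank}^0(\mathscr{S}) = \sum_{G\cdot v \in G\backslash V} \dim_k(\mathscr{S}_v)$$ is finite. If $H_c^0(X,\mathscr{S}) = 0$ or $H_c^0(X,\mathscr{S})$ is an irreducible representation of $G$, then $H_c^0(X,\mathscr{S})$ is isomorphic to a representation induced from the stabilizer of a vertex or edge; that is, there exist a subgroup $K\subset G$ which is the stabilizer of a vertex or of an edge of $X$, and a representation $\sigma$ of $K$ on a $k$-vector space, such that $H_c^0(X,\mathscr{S}) \cong \mathrm{cInd}_K^G \sigma$ as representations of $G$.
   Context: Let $X$ be a tree with vertex set $V$ and edge set $E$; for $v\in V$, $e\in E$ write $v<e$ (or $e>v$) if $v$ is an endpoint of $e$. A sheaf $(\mathscr{S},\gamma)$ on $X$ means a cellular sheaf of $k$-vector spaces: $k$-vector spaces $\mathscr{S}_v$ ($v\in V$) and $\mathscr{S}_e$ ($e\in E$), called stalks, and $k$-linear maps $\gamma_{v,e}:\mathscr{S}_v\to\mathscr{S}_e$ for all $v<e$. A $G$-equivariant structure on $(\mathscr{S},\gamma)$ consists of linear maps $\eta_{g,v}:\mathscr{S}_v\to\mathscr{S}_{gv}$ and $\eta_{g,e}:\mathscr{S}_e\to\mathscr{S}_{ge}$ for all $g\in G$, $v\in V$, $e\in E$, such that: $\eta_{1,v}$ and $\eta_{1,e}$ are identities; $\eta_{g,hv}\circ\eta_{h,v}=\eta_{gh,v}$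 and $\eta_{g,he}\circ\eta_{h,e}=\eta_{gh,e}$ for all $g,h\in G$; and $\gamma_{gv,ge}\circ\eta_{g,v}=\eta_{g,e}\circ\gamma_{v,e}$ for all $g\in G$ and $v<e$. A $G$-equivariant sheaf is a sheaf with a $G$-equivariant structure. Cohomology: fix an orientation of every edge $e$, i.e. an ordering $x_e,y_e$ of its endpoints, and for $v<e$ put $\mathrm{or}(v,e)=1$ if $v=x_e$ and $\mathrm{or}(v,e)=-1$ if $v=y_e$. For $s\in\mathscr{S}_v$ put $$\mathrm{d}s=\sum_{e>v}\mathrm{or}(v,e)\,\gamma_{v,e}(s)\in\bigoplus_{e>v}\mathscr{S}_e,$$ it being understood that, for each $v$ and $s\in\mathscr{S}_v$, only finitely many $\gamma_{v,e}(s)$ are nonzero (automatic if $X$ is locally finite). Extending linearly gives $\mathrm{d}:\bigoplus_{v\in V}\mathscr{S}_v\to\bigoplus_{e\in E}\mathscr{S}_e$, and $H_c^0(X,\mathscr{S})=\ker \mathrm{d}$. The group $G$ acts on $\bigoplus_{v\in V}\mathscr{S}_v$ via the maps $\eta_{g,v}$, and this makes $H_c^0(X,\mathscr{S})$ a representation of $G$. For a subgroup $K\subset G$ and a representation $(\sigma,S)$ of $K$, $\mathrm{cInd}_K^G\sigma$ denotes algebraic induction: the space of functions $f:G\to S$ supported on finitely many left $K$-cosets and satisfying $f(gk)=\sigma(k)^{-1}f(g)$ for all $g\in G$, $k\in K$, with $G$ acting by left translation. Here all representations are abstract (no topology); the stabilizer of an edge $e$ is $\{g\in G: ge=e\}$.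 *)

theory Defs
  imports
    "HOL-Algebra.Group_Action"
    "HOL-Algebra.Left_Coset"
    "HOL-Library.Function_Algebras"
    "HOL-Library.Extended_Nat"
begin

section \<open>Linear algebra and representations\<close>

text \<open>
  Vector spaces over the field \<open>'k\<close> are subspaces of an ambient vector space, given by a type
  \<open>'a\<close> and a scalar multiplication \<open>s\<close>. A family of vector spaces is always of this form up to
  isomorphism (embed the members in their direct sum).
  A linear map between such subspaces is only constrained on its domain.
\<close>

definition linear_on ::
  "('k \<Rightarrow> 'a \<Rightarrow> 'a) \<Rightarrow> ('k \<Rightarrow> 'b \<Rightarrow> 'b) \<Rightarrow> 'a::ab_group_add set \<Rightarrow> 'b::ab_group_add set \<Rightarrow> ('a \<Rightarrow> 'b) \<Rightarrow> bool"
  where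
  "linear_on s t A B f \<longleftrightarrow>
     f ` A \<subseteq> B \<and>
     (\<forall>x\<in>A. \<forall>y\<in>A. f (x + y) = f x + f y) \<and>
     (\<forall>c. \<forall>x\<in>A. f (s c x) = t c (f x))"

definition pw_scale :: "('k \<Rightarrow> 'a \<Rightarrow> 'a) \<Rightarrow> 'k \<Rightarrow> ('x \<Rightarrow> 'a) \<Rightarrow> ('x \<Rightarrow> 'a)" where
  "pw_scale s c f = (\<lambda>x. s c (f x))"

lemma vector_space_pw_scale:
  assumes "vector_space s"
  shows "vector_space (pw_scale s)"
proof -
  interpret vector_space s by fact
  show ?thesis
    by unfold_locales
      (auto simp: pw_scale_def fun_eq_iff scale_right_distrib scale_left_distrib)
qed

text \<open>Infinite dimensions are not distinguished from each other.\<close>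

definition edim :: "('k::field \<Rightarrow> 'a::ab_group_add \<Rightarrow> 'a) \<Rightarrow> 'a set \<Rightarrow> enat" where
  "edim s S =
     (if \<exists>B. finite B \<and> S \<subseteq> module.span s B then enat (vector_space.dim s S) else \<infinity>)"

locale linear_rep = group G + vector_space s
  for G :: "('g, 'm) monoid_scheme" (structure)
    and s :: "'k::field \<Rightarrow> 'a::ab_group_add \<Rightarrow> 'a" +
  fixes S :: "'a set" and \<sigma> :: "'g \<Rightarrow> 'a \<Rightarrow> 'a"
  assumes space: "subspace S"
    and linear: "g \<in> carrier G \<Longrightarrow> linear_on s s S S (\<sigma> g)"
    and one: "x \<in> S \<Longrightarrow> \<sigma> \<one> x = x"
    and mult: "\<lbrakk>g \<in> carrier G; h \<in> carrier G; x \<in> S\<rbrakk> \<Longrightarrow> \<sigma> (g \<otimes> h) x = \<sigma> g (\<sigma> h x)"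

definition irreducible_rep ::
  "('g, 'm) monoid_scheme \<Rightarrow> ('k::field \<Rightarrow> 'a::ab_group_add \<Rightarrow> 'a) \<Rightarrow> 'a set \<Rightarrow> ('g \<Rightarrow> 'a \<Rightarrow> 'a) \<Rightarrow> bool"
  where
  "irreducible_rep G s S \<sigma> \<longleftrightarrow>
     linear_rep G s S \<sigma> \<and> S \<noteq> {0} \<and>
     (\<forall>W. module.subspace s W \<and> W \<subseteq> S \<and> (\<forall>g\<in>carrier G. \<sigma> g ` W \<subseteq> W) \<longrightarrow> W = {0} \<or> W = S)"

definition isomorphic_reps ::
  "('g, 'm) monoid_scheme \<Rightarrow>
   ('k \<Rightarrow> 'a \<Rightarrow> 'a) \<Rightarrow> 'a::ab_group_add set \<Rightarrow> ('g \<Rightarrow> 'a \<Rightarrow> 'a) \<Rightarrow>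
   ('k \<Rightarrow> 'b \<Rightarrow> 'b) \<Rightarrow> 'b::ab_group_add set \<Rightarrow> ('g \<Rightarrow> 'b \<Rightarrow> 'b) \<Rightarrow> bool"
  where
  "isomorphic_reps G s S \<sigma> t T \<tau> \<longleftrightarrow>
     (\<exists>F. linear_on s t S T F \<and> bij_betw F S T \<and>
          (\<forall>g\<in>carrier G. \<forall>x\<in>S. F (\<sigma> g x) = \<tau> g (F x)))"

text \<open>
  Algebraic induction. Functions on the group \<open>G\<close> are extended by \<open>0\<close> outside its carrier.
\<close>

definition cInd ::
  "('g, 'm) monoid_scheme \<Rightarrow> 'g set \<Rightarrow> 'a::zero set \<Rightarrow> ('g \<Rightarrow> 'a \<Rightarrow> 'a) \<Rightarrow> ('g \<Rightarrow> 'a) set"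
  where
  "cInd G K S \<sigma> =
     {f. (\<forall>g\<in>carrier G. f g \<in> S) \<and> (\<forall>g. g \<notin> carrier G \<longrightarrow> f g = 0) \<and>
         finite {C \<in> lcosets\<^bsub>G\<^esub> K. \<exists>g\<in>C. f g \<noteq> 0} \<and>
         (\<forall>g\<in>carrier G. \<forall>k\<in>K. f (g \<otimes>\<^bsub>G\<^esub> k) = \<sigma> (inv\<^bsub>G\<^esub> k) (f g))}"

definition left_transl :: "('g, 'm) monoid_scheme \<Rightarrow> 'g \<Rightarrow> ('g \<Rightarrow> 'a::zero) \<Rightarrow> ('g \<Rightarrow> 'a)" where
  "left_transl G h f = (\<lambda>g. if g \<in> carrier G then f (inv\<^bsub>G\<^esub> h \<otimes>\<^bsub>G\<^esub> g) else 0)"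


section \<open>Trees\<close>

text \<open>Edges are two-element sets of vertices. Trees may be infinite.\<close>

locale graph_tree =
  fixes V :: "'v set" and E :: "'v set set"
  assumes nonempty: "V \<noteq> {}"
    and edge: "e \<in> E \<Longrightarrow> e \<subseteq> V \<and> card e = 2"
    and connected: "\<lbrakk>u \<in> V; w \<in> V\<rbrakk> \<Longrightarrow> (u, w) \<in> {(x, y). {x, y} \<in> E}\<^sup>*"
    and no_cycle:
      "\<nexists>p. length p \<ge> 3 \<and> distinct p \<and> (\<forall>i < length p. {p ! i, p ! (Suc i mod length p)} \<in> E)"

text \<open>A group acting by graph automorphisms; the action on edges is \<open>g e = act g ` e\<close>.\<close>

locale tree_action = graph_tree V E + group_action G V act
  for V :: "'v set" and E :: "'v set set"
    and G :: "('g, 'm) monoid_scheme" (structure) and act :: "'g \<Rightarrow> 'v \<Rightarrow> 'v" +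
  assumes edge_closed: "\<lbrakk>g \<in> carrier G; e \<in> E\<rbrakk> \<Longrightarrow> act g ` e \<in> E"

definition orientation :: "'v set set \<Rightarrow> ('v set \<Rightarrow> 'v) \<Rightarrow> ('v set \<Rightarrow> 'v) \<Rightarrow> bool" where
  "orientation E src tgt \<longleftrightarrow> (\<forall>e\<in>E. e = {src e, tgt e})"

definition or_sign :: "('v set \<Rightarrow> 'v) \<Rightarrow> ('v set \<Rightarrow> 'v) \<Rightarrow> 'v \<Rightarrow> 'v set \<Rightarrow> 'k::field" where
  "or_sign src tgt v e = (if v = src e then 1 else if v = tgt e then -1 else 0)"


section \<open>Equivariant cellular sheaves\<close>

text \<open>
  The last assumption is the standing one that makes the differential of a finitely supported
  cochain finitely supported.
\<close>

locale cellular_sheaf =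
  graph_tree V E + vs_V: vector_space sV + vs_E: vector_space sE
  for V :: "'v set" and E :: "'v set set"
    and sV :: "'k::field \<Rightarrow> 'a::ab_group_add \<Rightarrow> 'a"
    and sE :: "'k \<Rightarrow> 'b::ab_group_add \<Rightarrow> 'b" +
  fixes SV :: "'v \<Rightarrow> 'a set" and SE :: "'v set \<Rightarrow> 'b set"
    and \<gamma> :: "'v \<Rightarrow> 'v set \<Rightarrow> 'a \<Rightarrow> 'b"
  assumes stalk_V: "v \<in> V \<Longrightarrow> vs_V.subspace (SV v)"
    and stalk_E: "e \<in> E \<Longrightarrow> vs_E.subspace (SE e)"
    and restr_linear: "\<lbrakk>e \<in> E; v \<in> e\<rbrakk> \<Longrightarrow> linear_on sV sE (SV v) (SE e) (\<gamma> v e)"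
    and restr_finite: "\<lbrakk>v \<in> V; s \<in> SV v\<rbrakk> \<Longrightarrow> finite {e \<in> E. v \<in> e \<and> \<gamma> v e s \<noteq> 0}"

locale equivariant_sheaf =
  tree_action V E G act + cellular_sheaf V E sV sE SV SE \<gamma>
  for V :: "'v set" and E :: "'v set set"
    and G :: "('g, 'm) monoid_scheme" (structure) and act :: "'g \<Rightarrow> 'v \<Rightarrow> 'v"
    and sV :: "'k::field \<Rightarrow> 'a::ab_group_add \<Rightarrow> 'a"
    and sE :: "'k \<Rightarrow> 'b::ab_group_add \<Rightarrow> 'b"
    and SV :: "'v \<Rightarrow> 'a set" and SE :: "'v set \<Rightarrow> 'b set"
    and \<gamma> :: "'v \<Rightarrow> 'v set \<Rightarrow> 'a \<Rightarrow> 'b" +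
  fixes \<eta>V :: "'g \<Rightarrow> 'v \<Rightarrow> 'a \<Rightarrow> 'a" and \<eta>E :: "'g \<Rightarrow> 'v set \<Rightarrow> 'b \<Rightarrow> 'b"
  assumes \<eta>V_linear: "\<lbrakk>g \<in> carrier G; v \<in> V\<rbrakk> \<Longrightarrow> linear_on sV sV (SV v) (SV (act g v)) (\<eta>V g v)"
    and \<eta>E_linear: "\<lbrakk>g \<in> carrier G; e \<in> E\<rbrakk> \<Longrightarrow> linear_on sE sE (SE e) (SE (act g ` e)) (\<eta>E g e)"
    and \<eta>V_one: "\<lbrakk>v \<in> V; s \<in> SV v\<rbrakk> \<Longrightarrow> \<eta>V \<one> v s = s"
    and \<eta>E_one: "\<lbrakk>e \<in> E; t \<in> SE e\<rbrakk> \<Longrightarrow> \<eta>E \<one> e t = t"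
    and \<eta>V_mult: "\<lbrakk>g \<in> carrier G; h \<in> carrier G; v \<in> V; s \<in> SV v\<rbrakk> \<Longrightarrow>
      \<eta>V g (act h v) (\<eta>V h v s) = \<eta>V (g \<otimes> h) v s"
    and \<eta>E_mult: "\<lbrakk>g \<in> carrier G; h \<in> carrier G; e \<in> E; t \<in> SE e\<rbrakk> \<Longrightarrow>
      \<eta>E g (act h ` e) (\<eta>E h e t) = \<eta>E (g \<otimes> h) e t"
    and equivariant: "\<lbrakk>g \<in> carrier G; e \<in> E; v \<in> e; s \<in> SV v\<rbrakk> \<Longrightarrow>
      \<gamma> (act g v) (act g ` e) (\<eta>V g v s) = \<eta>E g e (\<gamma> v e s)"

text \<open>
  The rank, as the supremum of the finite partial sums over the (possibly infinite) set of orbits.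
  The dimension of the stalk does not depend on the chosen representative of the orbit.
\<close>

definition rank0 ::
  "'v set \<Rightarrow> ('g, 'm) monoid_scheme \<Rightarrow> ('g \<Rightarrow> 'v \<Rightarrow> 'v) \<Rightarrow>
   ('k::field \<Rightarrow> 'a::ab_group_add \<Rightarrow> 'a) \<Rightarrow> ('v \<Rightarrow> 'a set) \<Rightarrow> enat"
  where
  "rank0 V G act sV SV =
     (SUP F \<in> {F. finite F \<and> F \<subseteq> orbits G V act}. \<Sum>Q\<in>F. edim sV (SV (SOME v. v \<in> Q)))"


section \<open>Cohomology\<close>

text \<open>The direct sum of the vertex stalks: finitely supported sections, \<open>0\<close> outside \<open>V\<close>.\<close>

definition cochains0 :: "'v set \<Rightarrow> ('v \<Rightarrow> 'a::zero set) \<Rightarrow> ('v \<Rightarrow> 'a) set" where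
  "cochains0 V SV =
     {f. (\<forall>v\<in>V. f v \<in> SV v) \<and> (\<forall>v. v \<notin> V \<longrightarrow> f v = 0) \<and> finite {v. f v \<noteq> 0}}"

text \<open>\<open>diff_at \<dots> v s\<close> is the differential of a single element \<open>s\<close> of the stalk at \<open>v\<close>.\<close>

definition diff_at ::
  "'v set set \<Rightarrow> ('k::field \<Rightarrow> 'b::zero \<Rightarrow> 'b) \<Rightarrow> ('v \<Rightarrow> 'v set \<Rightarrow> 'a \<Rightarrow> 'b) \<Rightarrow>
   ('v set \<Rightarrow> 'v) \<Rightarrow> ('v set \<Rightarrow> 'v) \<Rightarrow> 'v \<Rightarrow> 'a \<Rightarrow> ('v set \<Rightarrow> 'b)"
  where
  "diff_at E sE \<gamma> src tgt v s =
     (\<lambda>e. if e \<in> E \<and> v \<in> e then sE (or_sign src tgt v e) (\<gamma> v e s) else 0)"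

definition diff ::
  "'v set set \<Rightarrow> ('k::field \<Rightarrow> 'b::ab_group_add \<Rightarrow> 'b) \<Rightarrow> ('v \<Rightarrow> 'v set \<Rightarrow> 'a::zero \<Rightarrow> 'b) \<Rightarrow>
   ('v set \<Rightarrow> 'v) \<Rightarrow> ('v set \<Rightarrow> 'v) \<Rightarrow> ('v \<Rightarrow> 'a) \<Rightarrow> ('v set \<Rightarrow> 'b)"
  where
  "diff E sE \<gamma> src tgt f = (\<Sum>v | f v \<noteq> 0. diff_at E sE \<gamma> src tgt v (f v))"

definition H0c ::
  "'v set \<Rightarrow> 'v set set \<Rightarrow> ('k::field \<Rightarrow> 'b::ab_group_add \<Rightarrow> 'b) \<Rightarrow> ('v \<Rightarrow> 'a::zero set) \<Rightarrow>
   ('v \<Rightarrow> 'v set \<Rightarrow> 'a \<Rightarrow> 'b) \<Rightarrow> ('v set \<Rightarrow> 'v) \<Rightarrow> ('v set \<Rightarrow> 'v) \<Rightarrow> ('v \<Rightarrow> 'a) set"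
  where
  "H0c V E sE SV \<gamma> src tgt = {f \<in> cochains0 V SV. diff E sE \<gamma> src tgt f = 0}"

text \<open>The action on cochains, \<open>(g f)(g v) = \<eta>V g v (f v)\<close>.\<close>

definition cochain_act ::
  "'v set \<Rightarrow> ('g, 'm) monoid_scheme \<Rightarrow> ('g \<Rightarrow> 'v \<Rightarrow> 'v) \<Rightarrow> ('g \<Rightarrow> 'v \<Rightarrow> 'a \<Rightarrow> 'a) \<Rightarrow>
   'g \<Rightarrow> ('v \<Rightarrow> 'a::zero) \<Rightarrow> ('v \<Rightarrow> 'a)"
  where
  "cochain_act V G act \<eta>V g f =
     (\<lambda>w. if w \<in> V then let v = act (inv\<^bsub>G\<^esub> g) w in \<eta>V g v (f v) else 0)"


section \<open>The spaces above are representations\<close>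

context equivariant_sheaf begin

sublocale grp: group G
  using group_hom group_hom.axioms(1) by blast

lemma actV: "g \<in> carrier G \<Longrightarrow> v \<in> V \<Longrightarrow> act g v \<in> V"
  using element_image by blast
lemma act_one: "v \<in> V \<Longrightarrow> act \<one> v = v"
  using id_eq_one by (metis restrict_apply')
lemma act_mult: "g \<in> carrier G \<Longrightarrow> h \<in> carrier G \<Longrightarrow> v \<in> V \<Longrightarrow> act (g \<otimes> h) v = act g (act h v)"
  by (rule composition_rule)
lemma act_inv1: "g \<in> carrier G \<Longrightarrow> v \<in> V \<Longrightarrow> act (inv g) (act g v) = v"
  by (metis act_mult act_one grp.inv_closed grp.l_inv)
lemma act_inv2: "g \<in> carrier G \<Longrightarrow> v \<in> V \<Longrightarrow> act g (act (inv g) v) = v"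
  by (metis act_mult act_one grp.inv_closed grp.r_inv)

lemma eta_zero: "g \<in> carrier G \<Longrightarrow> v \<in> V \<Longrightarrow> \<eta>V g v 0 = 0"
  using \<eta>V_linear[of g v] vs_V.subspace_0[OF stalk_V, of v] unfolding linear_on_def
  by (metis add_cancel_right_right)

lemma gamma_zero: "e \<in> E \<Longrightarrow> v \<in> e \<Longrightarrow> \<gamma> v e 0 = 0"
  using restr_linear[of e v] vs_V.subspace_0[OF stalk_V, of v] edge unfolding linear_on_def
  by (metis add_cancel_right_right subset_iff)

lemma diff_eq:
  assumes o: "orientation E src tgt" and f: "f \<in> cochains0 V SV" and e: "e \<in> E"
  shows "diff E sE \<gamma> src tgt f e = \<gamma> (src e) e (f (src e)) - \<gamma> (tgt e) e (f (tgt e))"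
proof -
  have ee: "e = {src e, tgt e}" using o e by (auto simp: orientation_def)
  have ne: "src e \<noteq> tgt e" using edge[OF e] ee by (metis card_1_singleton_iff insert_absorb2 numeral_eq_one_iff semiring_norm(85) One_nat_def)
  have fin: "finite {v. f v \<noteq> 0}" using f by (auto simp: cochains0_def)
  have A: "(\<Sum>v\<in>S. h v) e = (\<Sum>v\<in>S. h v e)" for S and h :: "'v \<Rightarrow> 'v set \<Rightarrow> 'b"
    by (induction S rule: infinite_finite_induct) auto
  have "diff E sE \<gamma> src tgt f e = (\<Sum>v | f v \<noteq> 0. diff_at E sE \<gamma> src tgt v (f v) e)"
    by (simp add: diff_def A)
  also have "\<dots> = (\<Sum>v \<in> {src e, tgt e}. diff_at E sE \<gamma> src tgt v (f v) e)"
  proof (rule sum.mono_neutral_cong[OF _ fin])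
    show "\<And>i. i \<in> {src e, tgt e} - {v. f v \<noteq> 0} \<Longrightarrow> diff_at E sE \<gamma> src tgt i (f i) e = 0"
      using gamma_zero ee e by (auto simp: diff_at_def)
    show "\<And>i. i \<in> {v. f v \<noteq> 0} - {src e, tgt e} \<Longrightarrow> diff_at E sE \<gamma> src tgt i (f i) e = 0"
      using ee by (auto simp: diff_at_def)
  qed auto
  also have "\<dots> = \<gamma> (src e) e (f (src e)) - \<gamma> (tgt e) e (f (tgt e))"
  proof -
    have "src e \<in> e" "tgt e \<in> e" using ee by auto
    then show ?thesis using ne e by (simp add: diff_at_def or_sign_def)
  qed
  finally show ?thesis .
qed

lemma H0c_iff:
  assumes o: "orientation E src tgt"
  shows "f \<in> H0c V E sE SV \<gamma> src tgt \<longleftrightarrow> f \<in> cochains0 V SV \<and>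
    (\<forall>e\<in>E. \<forall>u\<in>e. \<forall>w\<in>e. \<gamma> u e (f u) = \<gamma> w e (f w))"
proof (cases "f \<in> cochains0 V SV")
  case True
  have out: "diff E sE \<gamma> src tgt f e = 0" if "e \<notin> E" for e
  proof -
    have A: "(\<Sum>v\<in>S. h v) e = (\<Sum>v\<in>S. h v e)" for S and h :: "'v \<Rightarrow> 'v set \<Rightarrow> 'b"
      by (induction S rule: infinite_finite_induct) auto
    show ?thesis using that by (simp add: diff_def A diff_at_def)
  qed
  have "diff E sE \<gamma> src tgt f = 0 \<longleftrightarrow> (\<forall>e\<in>E. \<gamma> (src e) e (f (src e)) = \<gamma> (tgt e) e (f (tgt e)))"
    using diff_eq[OF o True] out by (force simp: fun_eq_iff)
  also have "\<dots> \<longleftrightarrow> (\<forall>e\<in>E. \<forall>u\<in>e. \<forall>w\<in>e. \<gamma> u e (f u) = \<gamma> w e (f w))"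
  proof -
    have "(\<forall>u\<in>e. \<forall>w\<in>e. \<gamma> u e (f u) = \<gamma> w e (f w)) \<longleftrightarrow> \<gamma> (src e) e (f (src e)) = \<gamma> (tgt e) e (f (tgt e))" if e: "e \<in> E" for e
    proof -
      have ee: "e = {src e, tgt e}" using o e by (auto simp: orientation_def)
      have "(\<forall>u\<in>{src e, tgt e}. \<forall>w\<in>{src e, tgt e}. \<gamma> u e (f u) = \<gamma> w e (f w)) \<longleftrightarrow> \<gamma> (src e) e (f (src e)) = \<gamma> (tgt e) e (f (tgt e))"
        by auto
      with ee show ?thesis by simp
    qed
    then show ?thesis by blast
  qed
  finally show ?thesis using True by (simp add: H0c_def)
qed (simp add: H0c_def)

lemma vsp: "vector_space (pw_scale sV :: _ \<Rightarrow> ('v \<Rightarrow> 'a) \<Rightarrow> _)"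
  by (rule vector_space_pw_scale) (rule vs_V.vector_space_axioms)

lemma act_cochains:
  assumes g: "g \<in> carrier G" and f: "f \<in> cochains0 V SV"
  shows "cochain_act V G act \<eta>V g f \<in> cochains0 V SV"
proof -
  have "cochain_act V G act \<eta>V g f v \<in> SV v" if v: "v \<in> V" for v
  proof -
    have w: "act (inv g) v \<in> V" using g v actV by simp
    have "f (act (inv g) v) \<in> SV (act (inv g) v)" using f w by (auto simp: cochains0_def)
    then show ?thesis using \<eta>V_linear[OF g w] v act_inv2[OF g v]
      by (auto simp: linear_on_def cochain_act_def Let_def)
  qed
  moreover have "finite {v. cochain_act V G act \<eta>V g f v \<noteq> 0}"
  proof (rule finite_subset)
    show "{v. cochain_act V G act \<eta>V g f v \<noteq> 0} \<subseteq> act g ` {v. f v \<noteq> 0}"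
    proof
      fix v assume "v \<in> {v. cochain_act V G act \<eta>V g f v \<noteq> 0}"
      then have v: "v \<in> V" and n: "\<eta>V g (act (inv g) v) (f (act (inv g) v)) \<noteq> 0"
        by (auto simp: cochain_act_def Let_def split: if_splits)
      then have "f (act (inv g) v) \<noteq> 0" using eta_zero[OF g actV] g by force
      then show "v \<in> act g ` {v. f v \<noteq> 0}" using act_inv2[OF g v] by force
    qed
    show "finite (act g ` {v. f v \<noteq> 0})" using f by (simp add: cochains0_def)
  qed
  ultimately show ?thesis by (auto simp: cochains0_def cochain_act_def)
qed

lemma H0c_rep:
  assumes o: "orientation E src tgt"
  shows "linear_rep G (pw_scale sV) (H0c V E sE SV \<gamma> src tgt) (cochain_act V G act \<eta>V)"
proof -
  interpret p: vector_space "pw_scale sV :: _ \<Rightarrow> ('v \<Rightarrow> 'a) \<Rightarrow> _" by (rule vsp)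
  let ?H = "H0c V E sE SV \<gamma> src tgt" and ?a = "cochain_act V G act \<eta>V"
  have sub0: "\<And>f g. f \<in> cochains0 V SV \<Longrightarrow> g \<in> cochains0 V SV \<Longrightarrow> f + g \<in> cochains0 V SV"
    "\<And>c f. f \<in> cochains0 V SV \<Longrightarrow> pw_scale sV c f \<in> cochains0 V SV"
    "0 \<in> cochains0 V SV"
  proof -
    fix f g :: "'v \<Rightarrow> 'a" assume fg: "f \<in> cochains0 V SV" "g \<in> cochains0 V SV"
    then have "finite ({v. f v \<noteq> 0} \<union> {v. g v \<noteq> 0})" by (simp add: cochains0_def)
    then have "finite {v. f v + g v \<noteq> 0}" by (rule rev_finite_subset) auto
    then show "f + g \<in> cochains0 V SV" using fg vs_V.subspace_add[OF stalk_V] by (auto simp: cochains0_def)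
  next
    fix c and f :: "'v \<Rightarrow> 'a" assume fg: "f \<in> cochains0 V SV"
    then have "finite {v. f v \<noteq> 0}" by (simp add: cochains0_def)
    then have "finite {v. sV c (f v) \<noteq> 0}" by (rule rev_finite_subset) auto
    then show "pw_scale sV c f \<in> cochains0 V SV" using fg vs_V.subspace_scale[OF stalk_V] by (auto simp: cochains0_def pw_scale_def)
  next
    show "0 \<in> cochains0 V SV" using vs_V.subspace_0[OF stalk_V] by (auto simp: cochains0_def)
  qed
  have lin: "\<gamma> v e (x + y) = \<gamma> v e x + \<gamma> v e y" "\<gamma> v e (sV c x) = sE c (\<gamma> v e x)"
    if "e \<in> E" "v \<in> e" "x \<in> SV v" "y \<in> SV v" for e v x y c
    using restr_linear[OF that(1,2)] that(3,4) by (auto simp: linear_on_def)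
  have mem: "f v \<in> SV v" if "f \<in> cochains0 V SV" "e \<in> E" "v \<in> e" for f v e
    using that edge by (auto simp: cochains0_def)
  have sp: "p.subspace ?H"
    unfolding p.subspace_def
  proof (intro conjI ballI allI)
    show "0 \<in> ?H" unfolding H0c_iff[OF o] using sub0(3) gamma_zero by simp
  next
    fix f g assume f: "f \<in> ?H" and g: "g \<in> ?H"
    then have c: "f \<in> cochains0 V SV" "g \<in> cochains0 V SV" by (auto simp: H0c_def)
    have "\<gamma> u e ((f + g) u) = \<gamma> w e ((f + g) w)" if e: "e \<in> E" "u \<in> e" "w \<in> e" for e u w
    proof -
      have "\<gamma> u e (f u) = \<gamma> w e (f w)" "\<gamma> u e (g u) = \<gamma> w e (g w)"
        using f g e unfolding H0c_iff[OF o] by blast+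
      then show ?thesis
        using lin(1)[OF e(1,2) mem[OF c(1) e(1,2)] mem[OF c(2) e(1,2)]]
          lin(1)[OF e(1,3) mem[OF c(1) e(1,3)] mem[OF c(2) e(1,3)]] by simp
    qed
    then show "f + g \<in> ?H" unfolding H0c_iff[OF o] using sub0(1)[OF c] by blast
  next
    fix c and f :: "'v \<Rightarrow> 'a" assume f: "f \<in> ?H"
    then have c: "f \<in> cochains0 V SV" by (auto simp: H0c_def)
    have "\<gamma> u e (pw_scale sV c f u) = \<gamma> w e (pw_scale sV c f w)" if e: "e \<in> E" "u \<in> e" "w \<in> e" for e u w
    proof -
      have "\<gamma> u e (f u) = \<gamma> w e (f w)"
        using f e unfolding H0c_iff[OF o] by blast+
      then show ?thesis
        using lin(2)[OF e(1,2) mem[OF c(1) e(1,2)] mem[OF c e(1,2)]]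
          lin(2)[OF e(1,3) mem[OF c(1) e(1,3)] mem[OF c e(1,3)]] by (simp add: pw_scale_def)
    qed
    then show "pw_scale sV c f \<in> ?H" unfolding H0c_iff[OF o] using sub0(2)[OF c] by blast
  qed
  have inH: "?a g f \<in> ?H" if g: "g \<in> carrier G" and f: "f \<in> ?H" for g f
    unfolding H0c_iff[OF o]
  proof (intro conjI ballI)
    have fc: "f \<in> cochains0 V SV" using f by (simp add: H0c_def)
    show "?a g f \<in> cochains0 V SV" using act_cochains[OF g fc] .
    fix e u w assume e: "e \<in> E" "u \<in> e" "w \<in> e"
    let ?e = "act (inv g) ` e"
    have e': "?e \<in> E" using edge_closed g e by simp
    have eV: "e \<subseteq> V" using edge e by blast
    have ge: "act g ` ?e = e" using act_inv2[OF g] eV by (force simp: image_image)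
    have K: "\<gamma> u e (?a g f u) = \<eta>E g ?e (\<gamma> (act (inv g) u) ?e (f (act (inv g) u)))" if "u \<in> e" for u
    proof -
      have u: "u \<in> V" using that eV by auto
      have u': "act (inv g) u \<in> ?e" using that by simp
      show ?thesis
        using equivariant[OF g e' u' mem[OF fc e' u']] ge act_inv2[OF g u] u
        by (simp add: cochain_act_def Let_def)
    qed
    have "\<gamma> (act (inv g) u) ?e (f (act (inv g) u)) = \<gamma> (act (inv g) w) ?e (f (act (inv g) w))"
      using f e e' unfolding H0c_iff[OF o] by blast
    then show "\<gamma> u e (?a g f u) = \<gamma> w e (?a g f w)" using K e by simp
  qed
  show ?thesis
  proof (unfold_locales)
    show "p.subspace ?H" by (rule sp)
    fix g assume g: "g \<in> carrier G"
    have fv: "f v \<in> SV v" if "f \<in> ?H" "v \<in> V" for f v using that by (auto simp: H0c_def cochains0_def)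
    have w: "v \<in> V \<Longrightarrow> act (inv g) v \<in> V" for v using actV g by simp
    have L1: "\<eta>V g v (x + y) = \<eta>V g v x + \<eta>V g v y"
      if "v \<in> V" "x \<in> SV v" "y \<in> SV v" for v x y
      using \<eta>V_linear[OF g that(1)] that by (auto simp: linear_on_def)
    have L2: "\<eta>V g v (sV c x) = sV c (\<eta>V g v x)"
      if "v \<in> V" "x \<in> SV v" for v x c
      using \<eta>V_linear[OF g that(1)] that by (auto simp: linear_on_def)
    show "linear_on (pw_scale sV) (pw_scale sV) ?H ?H (?a g)"
      unfolding linear_on_def using inH[OF g] L1 L2 fv w
      by (auto simp: cochain_act_def fun_eq_iff pw_scale_def Let_def)
  next
    fix f assume f: "f \<in> ?H"
    then show "?a \<one> f = f"
      using \<eta>V_one act_one by (auto simp: cochain_act_def fun_eq_iff H0c_def cochains0_def)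
  next
    fix g h f assume gh: "g \<in> carrier G" "h \<in> carrier G" and f: "f \<in> ?H"
    have fv: "f v \<in> SV v" if "v \<in> V" for v using that f by (auto simp: H0c_def cochains0_def)
    show "?a (g \<otimes> h) f = ?a g (?a h f)"
    proof
      fix v
      show "?a (g \<otimes> h) f v = ?a g (?a h f) v"
      proof (cases "v \<in> V")
        case True
        let ?v = "act (inv h) (act (inv g) v)"
        have gv: "act (inv g) v \<in> V" using True gh actV by simp
        have hv: "?v \<in> V" using gv gh actV by simp
        have "act (inv (g \<otimes> h)) v = ?v" using gh True act_mult by (simp add: grp.inv_mult_group)
        then show ?thesis using True gv \<eta>V_mult[OF gh hv fv[OF hv]] act_inv2[OF gh(2) gv]
          by (simp add: cochain_act_def Let_def)
      qed (simp add: cochain_act_def)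
    qed
  qed
qed

end

lemma cInd_rep:
  fixes G (structure)
  assumes G: "group G" and K: "subgroup K G" and r: "linear_rep (G\<lparr>carrier := K\<rparr>) s S \<sigma>"
  shows "linear_rep G (pw_scale s) (cInd G K S \<sigma>) (left_transl G)"
proof -
  interpret group G by fact
  interpret K: subgroup K G by fact
  interpret r: linear_rep "G\<lparr>carrier := K\<rparr>" s S \<sigma> by fact
  interpret p: vector_space "pw_scale s :: _ \<Rightarrow> ('a \<Rightarrow> _) \<Rightarrow> _"
    by (rule vector_space_pw_scale) (rule r.vector_space_axioms)
  have lin: "\<sigma> k (x + y) = \<sigma> k x + \<sigma> k y" "\<sigma> k (s c x) = s c (\<sigma> k x)"
    if "k \<in> K" "x \<in> S" "y \<in> S" for k x y c
    using r.linear[of k] that by (auto simp: linear_on_def)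
  have z: "\<sigma> k 0 = 0" if "k \<in> K" for k using lin(1)[OF that, of 0 0] r.subspace_0[OF r.space] by simp
  have sp: "p.subspace (cInd G K S \<sigma>)"
    unfolding p.subspace_def
  proof (intro conjI ballI allI)
    show "0 \<in> cInd G K S \<sigma>" using z r.subspace_0[OF r.space] by (auto simp: cInd_def)
  next
    fix f g assume f: "f \<in> cInd G K S \<sigma>" and g: "g \<in> cInd G K S \<sigma>"
    then have "finite ({C \<in> lcosets\<^bsub>G\<^esub> K. \<exists>x\<in>C. f x \<noteq> 0} \<union> {C \<in> lcosets\<^bsub>G\<^esub> K. \<exists>x\<in>C. g x \<noteq> 0})"
      by (auto simp: cInd_def)
    then have "finite {C \<in> lcosets\<^bsub>G\<^esub> K. \<exists>x\<in>C. f x + g x \<noteq> 0}"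
      by (rule rev_finite_subset) force
    then show "f + g \<in> cInd G K S \<sigma>" using f g lin r.subspace_add[OF r.space] by (auto simp: cInd_def)
  next
    fix c f assume f: "f \<in> cInd G K S \<sigma>"
    then have "finite {C \<in> lcosets\<^bsub>G\<^esub> K. \<exists>x\<in>C. f x \<noteq> 0}" by (auto simp: cInd_def)
    then have "finite {C \<in> lcosets\<^bsub>G\<^esub> K. \<exists>x\<in>C. s c (f x) \<noteq> 0}"
      by (rule rev_finite_subset) force
    then show "pw_scale s c f \<in> cInd G K S \<sigma>" using f lin r.subspace_scale[OF r.space] by (auto simp: cInd_def pw_scale_def)
  qed
  show ?thesis
  proof unfold_locales
    show "p.subspace (cInd G K S \<sigma>)" by (rule sp)
    fix h assume h: "h \<in> carrier G"
    have "left_transl G h f \<in> cInd G K S \<sigma>" if f: "f \<in> cInd G K S \<sigma>" for f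
    proof -
      have "finite ((\<lambda>C. h <# C) ` {C \<in> lcosets\<^bsub>G\<^esub> K. \<exists>x\<in>C. f x \<noteq> 0})"
        using f by (auto simp: cInd_def)
      moreover have "{C \<in> lcosets\<^bsub>G\<^esub> K. \<exists>x\<in>C. left_transl G h f x \<noteq> 0} \<subseteq> (\<lambda>C. h <# C) ` {C \<in> lcosets\<^bsub>G\<^esub> K. \<exists>x\<in>C. f x \<noteq> 0}"
      proof
        fix C assume "C \<in> {C \<in> lcosets\<^bsub>G\<^esub> K. \<exists>x\<in>C. left_transl G h f x \<noteq> 0}"
        then obtain a x where a: "a \<in> carrier G" "C = a <# K" and x: "x \<in> C" "x \<in> carrier G" "f (inv h \<otimes> x) \<noteq> 0"
          by (auto simp: LCOSETS_def left_transl_def split: if_splits)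
        have 1: "C = h <# ((inv h \<otimes> a) <# K)" using a h K.subset 
          by (metis inv_closed inv_solve_left lcos_m_assoc m_closed)
        have 2: "inv h \<otimes> x \<in> (inv h \<otimes> a) <# K" using x a h by (auto simp: l_coset_def m_assoc)
        show "C \<in> (\<lambda>C. h <# C) ` {C \<in> lcosets\<^bsub>G\<^esub> K. \<exists>x\<in>C. f x \<noteq> 0}"
          using 1 2 x a h by (auto simp: LCOSETS_def)
      qed
      ultimately have "finite {C \<in> lcosets\<^bsub>G\<^esub> K. \<exists>x\<in>C. left_transl G h f x \<noteq> 0}" by (rule finite_subset[rotated])
      then show ?thesis using f h by (auto simp: cInd_def left_transl_def m_assoc[symmetric])
    qed
    then show "linear_on (pw_scale s) (pw_scale s) (cInd G K S \<sigma>) (cInd G K S \<sigma>) (left_transl G h)"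
      using r.vector_space_axioms by (auto simp: linear_on_def left_transl_def pw_scale_def fun_eq_iff)
  next
    fix f assume "f \<in> cInd G K S \<sigma>"
    then show "left_transl G \<one> f = f" by (auto simp: left_transl_def cInd_def fun_eq_iff)
  next
    fix g h f assume "g \<in> carrier G" "h \<in> carrier G" "f \<in> cInd G K S \<sigma>"
    then show "left_transl G (g \<otimes> h) f = left_transl G g (left_transl G h f)"
      by (auto simp: left_transl_def fun_eq_iff inv_mult_group m_assoc)
  qed
qed

end

theory Submission
  imports Defs
begin

text \<open>
  The idea is to prune leaves of supports. Let \<open>H\<close> be the space of compactly supported sections. If some
  nonzero section is supported at a single vertex, then the sections supported at single vertices form
  an invariant direct sum indexed by vertices, and an irreducible \<open>H\<close> must be the sum over
  one orbit, that is, the induction of one summand from its stabilizer (Mackey's imprimitivity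
  argument, \<open>irreducible_imp_induced\<close>). If there is no such section, then the sum of the spaces of
  sections supported on single edges is direct as well (\<open>edges_independent\<close>), and the same argument
  applies as soon as one of them is nonzero.

  In the remaining case consider for \<open>v < e\<close> the germs at \<open>v\<close> that restrict to \<open>0\<close> on all edges at \<open>v\<close>
  other than \<open>e\<close>. These are the values that a section can have at a leaf of its support. Restriction
  embeds them into the stalk of \<open>e\<close>, with the images from the two ends of \<open>e\<close> independent,
  because no sections live at vertices or on edges. So these germs and their images form an equivariant
  subsheaf on which the differential is bijective, and dividing by it does not change \<open>H\<close>
  (\<open>ext_acyclic\<close>). It does change supports: a nonzero section has finite support, the
  support has a leaf since \<open>X\<close> is a tree (\<open>obtain_leaf\<close>), and the leaf is absorbed by the subsheaf
  (\<open>support_mod_ext_less\<close>). Following one fixed nonzero section, this cannot be repeated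
  indefinitely, so that after finitely many divisions one of the first two cases occurs.

  Instead of iterated quotients, the proof keeps the given sheaf and takes all notions above modulo
  an acyclic subsheaf \<open>L\<close>, by which one may divide without changing \<open>H\<close>. The iteration becomes a choice of
  \<open>L\<close> for which the support of the fixed section modulo \<open>L\<close> is as small as possible.
\<close>

section \<open>Systems of imprimitivity\<close>

text \<open>
  The action \<open>\<phi>\<close> on indices is given by its laws on \<open>I\<close> and not by a homomorphism into the extensional
  bijections of \<open>I\<close>, so that the image action \<open>\<lambda>g e. act g ` e\<close> on edges is an instance.
\<close>

locale imprimitivity_system = linear_rep G s H \<rho>
  for G :: "('g, 'm) monoid_scheme" (structure)
    and s :: "'k::field \<Rightarrow> 'c::ab_group_add \<Rightarrow> 'c"
    and H :: "'c set" and \<rho> :: "'g \<Rightarrow> 'c \<Rightarrow> 'c" +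
  fixes I :: "'i set" and \<phi> :: "'g \<Rightarrow> 'i \<Rightarrow> 'i" and W :: "'i \<Rightarrow> 'c set"
  assumes closed: "\<lbrakk>g \<in> carrier G; i \<in> I\<rbrakk> \<Longrightarrow> \<phi> g i \<in> I"
    and act_id: "i \<in> I \<Longrightarrow> \<phi> \<one> i = i"
    and act_comp: "\<lbrakk>g \<in> carrier G; h \<in> carrier G; i \<in> I\<rbrakk> \<Longrightarrow> \<phi> (g \<otimes> h) i = \<phi> g (\<phi> h i)"
    and sub: "i \<in> I \<Longrightarrow> subspace (W i)"
    and contained: "i \<in> I \<Longrightarrow> W i \<subseteq> H"
    and permuted: "\<lbrakk>g \<in> carrier G; i \<in> I; x \<in> W i\<rbrakk> \<Longrightarrow> \<rho> g x \<in> W (\<phi> g i)"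
    and independent: "\<lbrakk>finite A; A \<subseteq> I; \<And>i. i \<in> A \<Longrightarrow> c i \<in> W i; (\<Sum>i\<in>A. c i) = 0; j \<in> A\<rbrakk>
      \<Longrightarrow> c j = 0"
begin

lemma act_cancel:
  assumes "g \<in> carrier G" "i \<in> I"
  shows "\<phi> (inv g) (\<phi> g i) = i" "\<phi> g (\<phi> (inv g) i) = i"
  using assms act_comp[of "inv g" g i] act_comp[of g "inv g" i] act_id by simp_all

lemma rep_cancel:
  assumes "g \<in> carrier G" "x \<in> H"
  shows "\<rho> (inv g) (\<rho> g x) = x" "\<rho> g (\<rho> (inv g) x) = x"
  using assms mult[of "inv g" g x] mult[of g "inv g" x] one by simp_all

lemma rep_linear:
  assumes "g \<in> carrier G" "x \<in> H"
  shows "\<rho> g x \<in> H" "y \<in> H \<Longrightarrow> \<rho> g (x + y) = \<rho> g x + \<rho> g y" "\<rho> g (s a x) = s a (\<rho> g x)"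
  using linear[OF assms(1)] assms(2) by (auto simp: linear_on_def)

lemma rep_zero: "g \<in> carrier G \<Longrightarrow> \<rho> g 0 = 0"
  using rep_linear(3)[of g 0 0] subspace_0[OF space] by simp

lemma rep_sum:
  assumes "g \<in> carrier G" "\<And>i. i \<in> A \<Longrightarrow> c i \<in> H"
  shows "\<rho> g (\<Sum>i\<in>A. c i) = (\<Sum>i\<in>A. \<rho> g (c i))"
  using assms(2)
proof (induction A rule: infinite_finite_induct)
  case (insert x F)
  then have "(\<Sum>i\<in>F. c i) \<in> H" by (intro subspace_sum[OF space]) auto
  with insert show ?case using rep_linear(2)[OF assms(1)] by simp
qed (simp_all add: rep_zero assms(1))

text \<open>
  The sum map from the external direct sum of the \<open>W i\<close>. Families are finitely supported, so the
  sum over the support is additive although the support itself is not.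
\<close>

definition total :: "('i \<Rightarrow> 'c) \<Rightarrow> 'c" where
  "total c = (\<Sum>i | c i \<noteq> 0. c i)"

lemma total_eq:
  assumes "finite A" "{i. c i \<noteq> 0} \<subseteq> A"
  shows "total c = sum c A"
  unfolding total_def using assms by (intro sum.mono_neutral_left) auto

lemma total_add:
  assumes "finite {i. c i \<noteq> 0}" "finite {i. d i \<noteq> 0}"
  shows "total (c + d) = total c + total d"
proof -
  let ?A = "{i. c i \<noteq> 0} \<union> {i. d i \<noteq> 0}"
  have "total (c + d) = sum (c + d) ?A" "total c = sum c ?A" "total d = sum d ?A"
    using assms by (intro total_eq; auto)+
  then show ?thesis by (simp add: sum.distrib)
qed

lemma total_scale:
  assumes "finite {i. c i \<noteq> 0}"
  shows "total (pw_scale s a c) = s a (total c)"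
proof -
  have "total (pw_scale s a c) = sum (pw_scale s a c) {i. c i \<noteq> 0}"
    using assms by (intro total_eq) (auto simp: pw_scale_def)
  then show ?thesis by (simp add: total_def pw_scale_def scale_sum_right)
qed

context
  fixes i\<^sub>0 :: 'i
  assumes base: "i\<^sub>0 \<in> I"
begin

text \<open>
  The direct sum over one orbit has the same shape as a space of cochains, whence \<open>P\<close>.
\<close>

abbreviation K where "K \<equiv> stabilizer G \<phi> i\<^sub>0"
abbreviation Orb where "Orb \<equiv> orbit G \<phi> i\<^sub>0"
abbreviation P where "P \<equiv> cochains0 Orb W"

lemma stabilizer_is_subgroup: "subgroup K G"
proof
  fix x y assume "x \<in> K" "y \<in> K"
  then show "x \<otimes> y \<in> K" using base by (auto simp: stabilizer_def act_comp)
next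
  fix x assume "x \<in> K"
  then show "inv x \<in> K" using act_cancel(1)[of x i\<^sub>0] base by (auto simp: stabilizer_def)
qed (use base act_id in \<open>auto simp: stabilizer_def\<close>)

lemma stabilizer_rep: "linear_rep (G\<lparr>carrier := K\<rparr>) s (W i\<^sub>0) \<rho>"
proof -
  interpret K: group "G\<lparr>carrier := K\<rparr>"
    by (rule subgroup_imp_group[OF stabilizer_is_subgroup])
  have "W i\<^sub>0 \<subseteq> H" by (rule contained[OF base])
  moreover have "\<rho> g x \<in> W i\<^sub>0" if "g \<in> K" "x \<in> W i\<^sub>0" for g x
    using permuted[OF _ base, of g x] that by (auto simp: stabilizer_def)
  ultimately show ?thesis
    using sub[OF base] rep_linear mult one
    by unfold_locales (auto simp: linear_on_def subset_iff stabilizer_def)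
qed

lemma orbit_in: "Orb \<subseteq> I"
  using closed base by (auto simp: orbit_def)

lemma orbit_base: "g \<in> carrier G \<Longrightarrow> \<phi> g i\<^sub>0 \<in> Orb"
  by (auto simp: orbit_def)

lemma orbit_closed:
  assumes "g \<in> carrier G" "i \<in> Orb"
  shows "\<phi> g i \<in> Orb"
proof -
  obtain h where "h \<in> carrier G" "i = \<phi> h i\<^sub>0" using assms(2) by (auto simp: orbit_def)
  then show ?thesis using assms(1) base orbit_base[of "g \<otimes> h"] by (simp add: act_comp)
qed

text \<open>
  The left cosets of \<open>K\<close> correspond to the points of the orbit; this turns finite support
  of a family on the orbit into support on finitely many cosets, and conversely.
\<close>

lemma coset_eq_fibre:
  assumes "a \<in> carrier G"
  shows "a <# K = {g \<in> carrier G. \<phi> g i\<^sub>0 = \<phi> a i\<^sub>0}"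
proof (intro equalityI subsetI)
  fix g assume "g \<in> a <# K"
  then show "g \<in> {g \<in> carrier G. \<phi> g i\<^sub>0 = \<phi> a i\<^sub>0}"
    using assms base by (auto simp: l_coset_def stabilizer_def act_comp)
next
  fix g assume g: "g \<in> {g \<in> carrier G. \<phi> g i\<^sub>0 = \<phi> a i\<^sub>0}"
  then have "inv a \<otimes> g \<in> K"
    using assms base act_comp[of "inv a" g i\<^sub>0] act_cancel(1)[OF assms base]
    by (auto simp: stabilizer_def)
  moreover have "g = a \<otimes> (inv a \<otimes> g)" using assms g by (simp add: m_assoc[symmetric])
  ultimately show "g \<in> a <# K" unfolding l_coset_def by blast
qed

lemma P_simps:
  assumes "c \<in> P"
  shows "finite {i. c i \<noteq> 0}" "i \<in> Orb \<Longrightarrow> c i \<in> W i" "i \<notin> Orb \<Longrightarrow> c i = 0"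
    "c i \<in> H"
  using assms orbit_in contained subspace_0[OF space] 
  by (auto simp: cochains0_def) (metis subset_iff)+

lemma P_subspace:
  shows "c \<in> P \<Longrightarrow> d \<in> P \<Longrightarrow> c + d \<in> P" "c \<in> P \<Longrightarrow> pw_scale s a c \<in> P" "0 \<in> P"
proof -
  have sW: "subspace (W i)" if "i \<in> Orb" for i using sub that orbit_in by auto
  show "0 \<in> P" using subspace_0[OF sW] by (auto simp: cochains0_def)
  assume c: "c \<in> P"
  have "finite {i. s a (c i) \<noteq> 0}"
    by (rule finite_subset[OF _ P_simps(1)[OF c]]) auto
  with c show "pw_scale s a c \<in> P"
    using subspace_scale[OF sW] by (auto simp: cochains0_def pw_scale_def)
  assume d: "d \<in> P"
  have "finite {i. c i + d i \<noteq> 0}"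
    using P_simps(1)[OF c] P_simps(1)[OF d]
    by (auto intro: finite_subset[of _ "{i. c i \<noteq> 0} \<union> {i. d i \<noteq> 0}"])
  with c d show "c + d \<in> P"
    using subspace_add[OF sW] by (auto simp: cochains0_def)
qed

lemma total_in: "c \<in> P \<Longrightarrow> total c \<in> H"
  unfolding total_def by (intro subspace_sum[OF space]) (simp add: P_simps(4))

lemma total_eq_0:
  assumes "c \<in> P" "total c = 0"
  shows "c = 0"
proof (rule ccontr)
  assume "c \<noteq> 0"
  then obtain j where "c j \<noteq> 0" by (auto simp: fun_eq_iff)
  moreover have "{i. c i \<noteq> 0} \<subseteq> Orb" using P_simps(3)[OF assms(1)] by auto
  moreover have "c i \<in> W i" if "c i \<noteq> 0" for i
    using P_simps(2,3)[OF assms(1)] that by blast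
  ultimately show False
    using independent[of "{i. c i \<noteq> 0}" c j] assms(2) P_simps(1)[OF assms(1)] orbit_in
    by (auto simp: total_def)
qed

lemma total_inj: "inj_on total P"
proof (rule inj_onI)
  fix c d assume cd: "c \<in> P" "d \<in> P" "total c = total d"
  have m: "pw_scale s (-1) d \<in> P" using cd P_subspace by simp
  have "total (c + pw_scale s (-1) d) = total c + s (-1) (total d)"
    using total_add total_scale P_simps(1) cd m by metis
  then have "total (c + pw_scale s (-1) d) = 0" using cd by simp
  then have "c + pw_scale s (-1) d = 0" using total_eq_0 P_subspace(1)[OF cd(1) m] by blast
  then show "c = d" by (auto simp: fun_eq_iff pw_scale_def)
qed

text \<open>
  The action that makes \<open>total\<close> equivariant.
\<close>

definition translate :: "'g \<Rightarrow> ('i \<Rightarrow> 'c) \<Rightarrow> ('i \<Rightarrow> 'c)" where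
  "translate g c = (\<lambda>i. if i \<in> Orb then \<rho> g (c (\<phi> (inv g) i)) else 0)"

lemma translate_in_P:
  assumes g: "g \<in> carrier G" and c: "c \<in> P"
  shows "translate g c \<in> P" "total (translate g c) = \<rho> g (total c)"
proof -
  let ?A = "{i. c i \<noteq> 0}"
  have A: "?A \<subseteq> Orb" using P_simps(3)[OF c] by auto
  have sup: "{i. translate g c i \<noteq> 0} \<subseteq> \<phi> g ` ?A"
  proof
    fix i assume "i \<in> {i. translate g c i \<noteq> 0}"
    then have "i \<in> Orb" "c (\<phi> (inv g) i) \<noteq> 0" using rep_zero[OF g] 
      by (auto simp: translate_def split: if_splits)
    then show "i \<in> \<phi> g ` ?A" using act_cancel(2)[OF g, of i] orbit_in by force
  qed
  have "translate g c i \<in> W i" if i: "i \<in> Orb" for i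
    using permuted[OF g, of "\<phi> (inv g) i" "c (\<phi> (inv g) i)"] i orbit_in
      P_simps(2)[OF c, of "\<phi> (inv g) i"] orbit_closed[of "inv g" i] act_cancel(2)[OF g, of i] g
    by (simp add: translate_def subset_iff)
  then show "translate g c \<in> P"
    using finite_subset[OF sup] P_simps(1)[OF c] by (auto simp: cochains0_def translate_def)
  have inj: "inj_on (\<phi> g) ?A"
    using A orbit_in act_cancel(1)[OF g] by (intro inj_onI) (metis subset_iff)
  have "total (translate g c) = sum (translate g c) (\<phi> g ` ?A)"
    using P_simps(1)[OF c] sup by (intro total_eq) auto
  also have "\<dots> = (\<Sum>i\<in>?A. translate g c (\<phi> g i))"
    using inj by (simp add: sum.reindex)
  also have "\<dots> = (\<Sum>i\<in>?A. \<rho> g (c i))"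
    using A orbit_in orbit_closed[OF g] act_cancel(1)[OF g]
    by (intro sum.cong) (auto simp: translate_def subset_iff)
  also have "\<dots> = \<rho> g (total c)"
    unfolding total_def using rep_sum[OF g, of ?A c] P_simps(4)[OF c] by simp
  finally show "total (translate g c) = \<rho> g (total c)" .
qed

lemma orbit_sum_invariant:
  "subspace (total ` P)" "total ` P \<subseteq> H" "g \<in> carrier G \<Longrightarrow> \<rho> g ` total ` P \<subseteq> total ` P"
proof -
  have "total 0 = 0" by (simp add: total_def)
  then show "subspace (total ` P)"
    unfolding subspace_def
    using P_subspace total_add total_scale P_simps(1)
    by (auto simp: image_iff) metis+
  show "total ` P \<subseteq> H" using total_in by auto
  show "\<rho> g ` total ` P \<subseteq> total ` P" if "g \<in> carrier G"
    using translate_in_P[OF that] by (auto simp: image_iff) metis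
qed

lemma summand_in_orbit_sum: "W i\<^sub>0 \<subseteq> total ` P"
proof
  fix x assume x: "x \<in> W i\<^sub>0"
  let ?c = "\<lambda>i. if i = i\<^sub>0 then x else 0"
  have "i\<^sub>0 \<in> Orb" using orbit_base[of \<one>] act_id base by simp
  then have "?c \<in> P" using x subspace_0[OF sub] orbit_in by (auto simp: cochains0_def)
  moreover have "total ?c = sum ?c {i\<^sub>0}" by (intro total_eq) auto
  then have "total ?c = x" by simp
  ultimately show "x \<in> total ` P" by (metis (no_types, lifting) imageI)
qed

context
  assumes spans: "total ` P = H"
begin

definition component :: "'c \<Rightarrow> 'i \<Rightarrow> 'c" where
  "component = inv_into P total"

lemma component: "x \<in> H \<Longrightarrow> component x \<in> P" "x \<in> H \<Longrightarrow> total (component x) = x"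
  unfolding component_def using spans by (auto simp: inv_into_into f_inv_into_f)

lemma component_unique: "c \<in> P \<Longrightarrow> component (total c) = c"
  unfolding component_def by (rule inv_into_f_f[OF total_inj])

lemma component_add: "x \<in> H \<Longrightarrow> y \<in> H \<Longrightarrow> component (x + y) = component x + component y"
  using component_unique[of "component x + component y"] component P_subspace(1)
    total_add[OF P_simps(1) P_simps(1)] by metis

lemma component_scale: "x \<in> H \<Longrightarrow> component (s a x) = pw_scale s a (component x)"
  using component_unique[of "pw_scale s a (component x)"] component P_subspace(2)
    total_scale[OF P_simps(1)] by metis

lemma component_translate:
  "g \<in> carrier G \<Longrightarrow> x \<in> H \<Longrightarrow> component (\<rho> g x) = translate g (component x)"
  using component_unique[of "translate g (component x)"] component translate_in_P by metis

text \<open>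
  The value at \<open>g\<close> is the component in \<open>W (\<phi> g i\<^sub>0)\<close> transported back to \<open>W i\<^sub>0\<close>. The
  transport by \<open>inv g\<close> is what produces the equivariance of \<open>cInd\<close> under \<open>K\<close> on the right.
\<close>

definition coefficient :: "'c \<Rightarrow> 'g \<Rightarrow> 'c" where
  "coefficient x = (\<lambda>g. if g \<in> carrier G then \<rho> (inv g) (component x (\<phi> g i\<^sub>0)) else 0)"

lemma coefficient_in_cInd:
  assumes x: "x \<in> H"
  shows "coefficient x \<in> cInd G K (W i\<^sub>0) \<rho>"
proof -
  have c: "component x \<in> P" using component x by blast
  have "coefficient x g \<in> W i\<^sub>0" if g: "g \<in> carrier G" for g
    using permuted[of "inv g" "\<phi> g i\<^sub>0" "component x (\<phi> g i\<^sub>0)"] g closed[OF g base]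
      P_simps(2)[OF c orbit_base[OF g]] act_cancel(1)[OF g base]
    by (auto simp: coefficient_def)
  moreover have "finite {C \<in> lcosets K. \<exists>g\<in>C. coefficient x g \<noteq> 0}"
  proof (rule finite_subset)
    show "finite ((\<lambda>i. {g \<in> carrier G. \<phi> g i\<^sub>0 = i}) ` {i. component x i \<noteq> 0})"
      using P_simps(1)[OF c] by simp
    show "{C \<in> lcosets K. \<exists>g\<in>C. coefficient x g \<noteq> 0}
      \<subseteq> (\<lambda>i. {g \<in> carrier G. \<phi> g i\<^sub>0 = i}) ` {i. component x i \<noteq> 0}"
    proof
      fix C assume "C \<in> {C \<in> lcosets K. \<exists>g\<in>C. coefficient x g \<noteq> 0}"
      then obtain a g where a: "a \<in> carrier G" "C = a <# K" and g: "g \<in> C" "coefficient x g \<noteq> 0"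
        by (auto simp: LCOSETS_def)
      have C: "C = {g \<in> carrier G. \<phi> g i\<^sub>0 = \<phi> a i\<^sub>0}" using coset_eq_fibre a by simp
      then have "component x (\<phi> a i\<^sub>0) \<noteq> 0" using g rep_zero by (auto simp: coefficient_def)
      then show "C \<in> (\<lambda>i. {g \<in> carrier G. \<phi> g i\<^sub>0 = i}) ` {i. component x i \<noteq> 0}"
        using C by auto
    qed
  qed
  moreover have "coefficient x (g \<otimes> k) = \<rho> (inv k) (coefficient x g)"
    if "g \<in> carrier G" "k \<in> K" for g k
    using that base P_simps(4)[OF c]
    by (auto simp: coefficient_def stabilizer_def act_comp inv_mult_group mult)
  ultimately show ?thesis by (auto simp: cInd_def coefficient_def)
qed

text \<open>
  A function \<open>f\<close> in the induced space prescribes the component \<open>\<rho> g (f g)\<close> at \<open>\<phi> g i\<^sub>0\<close>. By the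
  equivariance of \<open>f\<close> it depends on the coset of \<open>g\<close> only.
\<close>

lemma coefficient_surj:
  assumes f: "f \<in> cInd G K (W i\<^sub>0) \<rho>"
  shows "f \<in> coefficient ` H"
proof -
  have fW: "f g \<in> W i\<^sub>0" if "g \<in> carrier G" for g using f that by (auto simp: cInd_def)
  have fH: "f g \<in> H" if "g \<in> carrier G" for g using fW[OF that] contained[OF base] by auto
  define c where "c i = (if i \<in> Orb then
      let g = SOME g. g \<in> carrier G \<and> \<phi> g i\<^sub>0 = i in \<rho> g (f g) else 0)" for i
  have c: "c (\<phi> g i\<^sub>0) = \<rho> g (f g)" if g: "g \<in> carrier G" for g
  proof -
    define h where "h = (SOME h. h \<in> carrier G \<and> \<phi> h i\<^sub>0 = \<phi> g i\<^sub>0)"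
    have h: "h \<in> carrier G" "\<phi> h i\<^sub>0 = \<phi> g i\<^sub>0"
      using someI[of "\<lambda>h. h \<in> carrier G \<and> \<phi> h i\<^sub>0 = \<phi> g i\<^sub>0" g] g unfolding h_def by auto
    then have "h \<in> g <# K" using coset_eq_fibre[OF g] by simp
    then obtain k where k: "k \<in> K" "h = g \<otimes> k" by (auto simp: l_coset_def)
    then have kG: "k \<in> carrier G" by (simp add: stabilizer_def)
    have "f h = \<rho> (inv k) (f g)" using f g k by (auto simp: cInd_def)
    then have "\<rho> h (f h) = \<rho> g (f g)"
      using k kG g fH[OF g] rep_linear(1) rep_cancel(2) by (simp add: mult)
    then show ?thesis using orbit_base[OF g] by (simp add: c_def h_def Let_def)
  qed
  have "c i \<in> W i" if "i \<in> Orb" for i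
    using that c permuted[OF _ base fW] by (auto simp: orbit_def)
  moreover have "finite {i. c i \<noteq> 0}"
  proof (rule finite_subset)
    show "finite ((\<lambda>C. \<phi> (SOME g. g \<in> C) i\<^sub>0) ` {C \<in> lcosets K. \<exists>g\<in>C. f g \<noteq> 0})"
      using f by (simp add: cInd_def)
    show "{i. c i \<noteq> 0} \<subseteq> (\<lambda>C. \<phi> (SOME g. g \<in> C) i\<^sub>0) ` {C \<in> lcosets K. \<exists>g\<in>C. f g \<noteq> 0}"
    proof
      fix i assume i: "i \<in> {i. c i \<noteq> 0}"
      then have "i \<in> Orb" by (cases "i \<in> Orb") (simp_all add: c_def)
      then obtain g where g: "g \<in> carrier G" "i = \<phi> g i\<^sub>0" by (auto simp: orbit_def)
      then have n: "f g \<noteq> 0" using i c rep_zero by auto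
      have gC: "g \<in> g <# K" using coset_eq_fibre[OF g(1)] g by auto
      then have "(SOME x. x \<in> g <# K) \<in> g <# K" by (rule someI)
      then have "\<phi> (SOME x. x \<in> g <# K) i\<^sub>0 = i" using coset_eq_fibre[OF g(1)] g by auto
      moreover have "g <# K \<in> lcosets K" using g by (auto simp: LCOSETS_def)
      ultimately show "i \<in> (\<lambda>C. \<phi> (SOME g. g \<in> C) i\<^sub>0) ` {C \<in> lcosets K. \<exists>g\<in>C. f g \<noteq> 0}"
        using gC n by (intro image_eqI[of _ _ "g <# K"]) auto
    qed
  qed
  ultimately have cP: "c \<in> P" by (auto simp: cochains0_def c_def)
  have "coefficient (total c) = f"
  proof
    fix g show "coefficient (total c) g = f g"
    proof (cases "g \<in> carrier G")
      case True
      then show ?thesis using c fH rep_cancel(1) component_unique[OF cP]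
        by (simp add: coefficient_def)
    next
      case False
      then show ?thesis using f by (simp add: coefficient_def cInd_def)
    qed
  qed
  then show ?thesis using total_in[OF cP] by (metis imageI)
qed

lemma isomorphic_to_cInd:
  "isomorphic_reps G s H \<rho> (pw_scale s) (cInd G K (W i\<^sub>0) \<rho>) (left_transl G)"
  unfolding isomorphic_reps_def
proof (intro exI conjI ballI)
  have cH: "component x i \<in> H" if "x \<in> H" for x i using P_simps(4) component that by blast
  show "linear_on s (pw_scale s) H (cInd G K (W i\<^sub>0) \<rho>) coefficient"
    using coefficient_in_cInd rep_linear(2,3) cH component_add component_scale
    by (auto simp: linear_on_def coefficient_def fun_eq_iff pw_scale_def)
  show "bij_betw coefficient H (cInd G K (W i\<^sub>0) \<rho>)"
    unfolding bij_betw_def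
  proof (intro conjI equalityI)
    show "inj_on coefficient H"
    proof (rule inj_onI)
      fix x y assume xy: "x \<in> H" "y \<in> H" "coefficient x = coefficient y"
      have "component x i = component y i" for i
      proof (cases "i \<in> Orb")
        case True
        then obtain g where g: "g \<in> carrier G" "i = \<phi> g i\<^sub>0" by (auto simp: orbit_def)
        have "\<rho> (inv g) (component x i) = \<rho> (inv g) (component y i)"
          using fun_cong[OF xy(3), of g] g by (simp add: coefficient_def)
        then show ?thesis using rep_cancel(2)[OF g(1)] cH xy by metis
      next
        case False
        then show ?thesis using P_simps(3) component xy by metis
      qed
      then show "x = y" using component(2) xy by (metis ext)
    qed
  qed (use coefficient_in_cInd coefficient_surj in auto)
  fix g x assume g: "g \<in> carrier G" and x: "x \<in> H"
  have "coefficient (\<rho> g x) h = coefficient x (inv g \<otimes> h)" if h: "h \<in> carrier G" for h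
    using g h x base cH orbit_base component_translate
    by (simp add: coefficient_def translate_def inv_mult_group mult act_comp)
  then show "coefficient (\<rho> g x) = left_transl G g (coefficient x)"
    by (auto simp: left_transl_def fun_eq_iff coefficient_def)
qed

end

text \<open>
  The sum of the \<open>W i\<close> over the orbit of \<open>i\<^sub>0\<close> is a nonzero invariant subspace, hence everything.
\<close>

theorem irreducible_imp_induced:
  assumes "irreducible_rep G s H \<rho>" "W i\<^sub>0 \<noteq> {0}"
  shows "isomorphic_reps G s H \<rho> (pw_scale s) (cInd G K (W i\<^sub>0) \<rho>) (left_transl G)"
proof -
  have "total ` P \<noteq> {0}"
    using summand_in_orbit_sum assms(2) subspace_0[OF sub[OF base]] by auto
  then have "total ` P = H"
    using assms(1) orbit_sum_invariant unfolding irreducible_rep_def by blast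
  then show ?thesis by (rule isomorphic_to_cInd)
qed

end

end


section \<open>Leaves of finite subforests\<close>

text \<open>
  The end of a longest path in \<open>F\<close>: all its neighbours in \<open>F\<close> lie on the path by maximality, and one
  that is not the next vertex of the path would close a cycle.
\<close>

lemma (in graph_tree) obtain_leaf:
  assumes F: "finite F" "F \<noteq> {}"
  obtains u where "u \<in> F"
    "\<forall>e\<in>E. \<forall>e'\<in>E. u \<in> e \<and> u \<in> e' \<and> e \<subseteq> F \<and> e' \<subseteq> F \<longrightarrow> e = e'"
proof -
  define path where "path p \<longleftrightarrow> p \<noteq> [] \<and> distinct p \<and> set p \<subseteq> F \<and>
    (\<forall>i. Suc i < length p \<longrightarrow> {p ! i, p ! Suc i} \<in> E)" for p
  obtain x where "x \<in> F" using F by auto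
  then have "path [x]" by (simp add: path_def)
  moreover have "length p \<le> card F" if "path p" for p
    using that F(1) by (metis path_def card_mono distinct_card)
  ultimately obtain p where p: "path p" and longest: "\<And>q. path q \<Longrightarrow> length q \<le> length p"
    using ex_has_greatest_nat[of path "[x]" length "Suc (card F)"] by (auto simp: less_Suc_eq_le)
  let ?u = "p ! 0"
  have u: "?u \<in> F" using p by (auto simp: path_def)
  have on_path: "\<exists>i. 0 < i \<and> i < length p \<and> p ! i = w"
    if e: "{?u, w} \<in> E" and w: "w \<in> F" for w
  proof -
    have "w \<noteq> ?u" using edge[OF e] by auto
    have "w \<in> set p"
    proof (rule ccontr)
      assume "w \<notin> set p"
      have "{(w # p) ! i, (w # p) ! Suc i} \<in> E" if "Suc i < length (w # p)" for i
        using that p e by (cases i) (auto simp: path_def insert_commute)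
      with p w \<open>w \<notin> set p\<close> have "path (w # p)" by (auto simp: path_def)
      then show False using longest by fastforce
    qed
    then show ?thesis using \<open>w \<noteq> ?u\<close> by (metis in_set_conv_nth not_gr_zero)
  qed
  have first: "i = 1" if e: "{?u, p ! i} \<in> E" and i: "0 < i" "i < length p" for i
  proof (rule ccontr)
    assume "i \<noteq> 1"
    \<comment> \<open>The initial segment up to \<open>p ! i\<close> is closed to a cycle by the edge from \<open>p ! i\<close> to \<open>p ! 0\<close>.\<close>
    let ?q = "take (Suc i) p"
    have len: "length ?q = Suc i" using i by simp
    have "{?q ! j, ?q ! (Suc j mod length ?q)} \<in> E" if "j < length ?q" for j
    proof (cases "j = i")
      case True
      then show ?thesis using e len by (simp add: insert_commute)
    next
      case False
      then have "Suc j < Suc i" using that len by simp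
      then show ?thesis using p i len by (simp add: path_def)
    qed
    moreover have "distinct ?q" using p by (simp add: path_def)
    moreover have "length ?q \<ge> 3" using len i \<open>i \<noteq> 1\<close> by simp
    ultimately show False using no_cycle by blast
  qed
  have "e = {?u, p ! 1}" if e: "e \<in> E" "?u \<in> e" "e \<subseteq> F" for e
  proof -
    obtain w where "e = {?u, w}"
      using edge[OF e(1)] e(2) by (metis card_2_iff doubleton_eq_iff insertE singletonD)
    then show ?thesis using on_path[of w] first e by force
  qed
  then show ?thesis using that[OF u] by metis
qed


section \<open>The differential and its kernel\<close>

locale oriented_sheaf = equivariant_sheaf V E G act sV sE SV SE \<gamma> \<eta>V \<eta>E
  for V :: "'v set" and E :: "'v set set"
    and G :: "('g, 'm) monoid_scheme" (structure) and act :: "'g \<Rightarrow> 'v \<Rightarrow> 'v"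
    and sV :: "'k::field \<Rightarrow> 'a::ab_group_add \<Rightarrow> 'a"
    and sE :: "'k \<Rightarrow> 'b::ab_group_add \<Rightarrow> 'b"
    and SV :: "'v \<Rightarrow> 'a set" and SE :: "'v set \<Rightarrow> 'b set"
    and \<gamma> :: "'v \<Rightarrow> 'v set \<Rightarrow> 'a \<Rightarrow> 'b"
    and \<eta>V :: "'g \<Rightarrow> 'v \<Rightarrow> 'a \<Rightarrow> 'a" and \<eta>E :: "'g \<Rightarrow> 'v set \<Rightarrow> 'b \<Rightarrow> 'b" +
  fixes src tgt :: "'v set \<Rightarrow> 'v"
  assumes oriented: "orientation E src tgt"
begin

abbreviation C0 where "C0 \<equiv> cochains0 V SV"
abbreviation d where "d \<equiv> diff E sE \<gamma> src tgt"
abbreviation H where "H \<equiv> H0c V E sE SV \<gamma> src tgt"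
abbreviation \<rho> where "\<rho> \<equiv> cochain_act V G act \<eta>V"

sublocale cochain: vector_space "pw_scale sV :: 'k \<Rightarrow> ('v \<Rightarrow> 'a) \<Rightarrow> 'v \<Rightarrow> 'a"
  by (rule vsp)

lemmas H_iff = H0c_iff[OF oriented]
lemmas d_eq = diff_eq[OF oriented]

lemma ends:
  assumes "e \<in> E"
  shows "e = {src e, tgt e}" "src e \<noteq> tgt e" "src e \<in> e" "tgt e \<in> e" "src e \<in> V" "tgt e \<in> V"
proof -
  show *: "e = {src e, tgt e}" using oriented assms by (auto simp: orientation_def)
  show "src e \<noteq> tgt e" using edge[OF assms] * by (metis card_2_iff doubleton_eq_iff insert_absorb2)
  show "src e \<in> e" "tgt e \<in> e" using * by auto
  then show "src e \<in> V" "tgt e \<in> V" using edge[OF assms] by auto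
qed

lemma vertex_of_edge: "e \<in> E \<Longrightarrow> v \<in> e \<Longrightarrow> v \<in> V"
  using edge by blast

lemma distinct_edges_miss:
  assumes "e \<in> E" "e' \<in> E" "e \<noteq> e'"
  obtains z where "z \<in> e" "z \<notin> e'"
proof -
  have "\<not> e \<subseteq> e'"
    using assms edge[of e] edge[of e'] card_subset_eq[of e' e] by (metis card.infinite zero_neq_numeral)
  then show ?thesis using that by blast
qed

lemma gamma_in: "\<lbrakk>e \<in> E; v \<in> e; x \<in> SV v\<rbrakk> \<Longrightarrow> \<gamma> v e x \<in> SE e"
  using restr_linear[of e v] by (auto simp: linear_on_def)

lemma gamma_add: "\<lbrakk>e \<in> E; v \<in> e; x \<in> SV v; y \<in> SV v\<rbrakk> \<Longrightarrow> \<gamma> v e (x + y) = \<gamma> v e x + \<gamma> v e y"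
  using restr_linear[of e v] by (auto simp: linear_on_def)

lemma gamma_scale: "\<lbrakk>e \<in> E; v \<in> e; x \<in> SV v\<rbrakk> \<Longrightarrow> \<gamma> v e (sV c x) = sE c (\<gamma> v e x)"
  using restr_linear[of e v] by (auto simp: linear_on_def)

lemma gamma_minus: "\<lbrakk>e \<in> E; v \<in> e; x \<in> SV v\<rbrakk> \<Longrightarrow> \<gamma> v e (- x) = - \<gamma> v e x"
  using gamma_scale[of e v x "-1"] by simp

lemma gamma_diff: "\<lbrakk>e \<in> E; v \<in> e; x \<in> SV v; y \<in> SV v\<rbrakk> \<Longrightarrow> \<gamma> v e (x - y) = \<gamma> v e x - \<gamma> v e y"
  using gamma_add[of e v x "- y"] gamma_minus[of e v y] vs_V.subspace_neg[OF stalk_V] vertex_of_edge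
  by simp

lemma \<eta>E_add:
  "\<lbrakk>g \<in> carrier G; e \<in> E; x \<in> SE e; y \<in> SE e\<rbrakk> \<Longrightarrow> \<eta>E g e (x + y) = \<eta>E g e x + \<eta>E g e y"
  using \<eta>E_linear[of g e] by (auto simp: linear_on_def)

lemma \<eta>E_diff:
  assumes g: "g \<in> carrier G" and e: "e \<in> E" and xy: "x \<in> SE e" "y \<in> SE e"
  shows "\<eta>E g e (x - y) = \<eta>E g e x - \<eta>E g e y"
  using \<eta>E_add[OF g e vs_E.subspace_diff[OF stalk_E[OF e] xy] xy(2)] by simp

lemma C0_value: "f \<in> C0 \<Longrightarrow> v \<in> V \<Longrightarrow> f v \<in> SV v"
  by (auto simp: cochains0_def)

lemma C0_diff:
  assumes "f \<in> C0" "g \<in> C0"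
  shows "f - g \<in> C0"
proof -
  have "finite ({v. f v \<noteq> 0} \<union> {v. g v \<noteq> 0})" using assms by (simp add: cochains0_def)
  then have "finite {v. f v - g v \<noteq> 0}" by (rule rev_finite_subset) auto
  then show ?thesis using assms vs_V.subspace_diff[OF stalk_V] by (auto simp: cochains0_def)
qed

lemma d_diff: "\<lbrakk>f \<in> C0; g \<in> C0; e \<in> E\<rbrakk> \<Longrightarrow> d (f - g) e = d f e - d g e"
  by (simp add: d_eq C0_diff C0_value ends(3-6) gamma_diff algebra_simps)

text \<open>
  The support of \<open>f\<close> is finite, and each of its values has finitely many nonzero restrictions.
\<close>

lemma d_finite:
  assumes "f \<in> C0"
  shows "finite {e \<in> E. d f e \<noteq> 0}"
proof (rule finite_subset)
  show "finite (\<Union>v\<in>{v. f v \<noteq> 0}. {e \<in> E. v \<in> e \<and> \<gamma> v e (f v) \<noteq> 0})"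
    using assms restr_finite C0_value[OF assms] by (intro finite_UN_I) (auto simp: cochains0_def)
  show "{e \<in> E. d f e \<noteq> 0} \<subseteq> (\<Union>v\<in>{v. f v \<noteq> 0}. {e \<in> E. v \<in> e \<and> \<gamma> v e (f v) \<noteq> 0})"
  proof
    fix e assume "e \<in> {e \<in> E. d f e \<noteq> 0}"
    then have e: "e \<in> E" and "\<gamma> (src e) e (f (src e)) \<noteq> 0 \<or> \<gamma> (tgt e) e (f (tgt e)) \<noteq> 0"
      using d_eq[OF assms] by auto
    then obtain v where "v \<in> e" "\<gamma> v e (f v) \<noteq> 0" using ends(3,4) by blast
    then show "e \<in> (\<Union>v\<in>{v. f v \<noteq> 0}. {e \<in> E. v \<in> e \<and> \<gamma> v e (f v) \<noteq> 0})"
      using e gamma_zero by force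
  qed
qed

lemma H_C0: "f \<in> H \<Longrightarrow> f \<in> C0"
  by (simp add: H0c_def)

lemma H_value: "f \<in> H \<Longrightarrow> v \<in> V \<Longrightarrow> f v \<in> SV v"
  using H_C0 C0_value by blast

lemma H_compatible: "\<lbrakk>f \<in> H; e \<in> E; u \<in> e; w \<in> e\<rbrakk> \<Longrightarrow> \<gamma> u e (f u) = \<gamma> w e (f w)"
  using H_iff by blast

lemma H_rep: "linear_rep G (pw_scale sV) H \<rho>"
  by (rule H0c_rep[OF oriented])

lemma H_subspace: "cochain.subspace H"
  using H_rep by (rule linear_rep.space)

lemma edge_act_inv:
  assumes "g \<in> carrier G" "e \<in> E"
  shows "act g ` act (inv g) ` e = e"
proof -
  have "e \<subseteq> V" using edge assms by blast
  then show ?thesis using act_inv2[OF assms(1)] by (force simp: image_image)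
qed

end

section \<open>Acyclic subsheaves\<close>

text \<open>
  An equivariant subsheaf \<open>L\<close> such that passing to the quotient sheaf leaves the cohomology
  in degree zero unchanged: a section of the quotient is a cochain \<open>f\<close> whose differential lies in \<open>L\<close>, and
  \<open>lift\<close> and \<open>no_section\<close> say that it is represented by exactly one section of the given sheaf. The
  pair \<open>LV\<close>, \<open>LE\<close> is kept instead of the quotient, so that all sheaves have the same sections \<open>H\<close>.
\<close>

locale acyclic_subsheaf = oriented_sheaf V E G act sV sE SV SE \<gamma> \<eta>V \<eta>E src tgt
  for V :: "'v set" and E :: "'v set set"
    and G :: "('g, 'm) monoid_scheme" (structure) and act :: "'g \<Rightarrow> 'v \<Rightarrow> 'v"
    and sV :: "'k::field \<Rightarrow> 'a::ab_group_add \<Rightarrow> 'a"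
    and sE :: "'k \<Rightarrow> 'b::ab_group_add \<Rightarrow> 'b"
    and SV :: "'v \<Rightarrow> 'a set" and SE :: "'v set \<Rightarrow> 'b set"
    and \<gamma> :: "'v \<Rightarrow> 'v set \<Rightarrow> 'a \<Rightarrow> 'b"
    and \<eta>V :: "'g \<Rightarrow> 'v \<Rightarrow> 'a \<Rightarrow> 'a" and \<eta>E :: "'g \<Rightarrow> 'v set \<Rightarrow> 'b \<Rightarrow> 'b"
    and src tgt :: "'v set \<Rightarrow> 'v" +
  fixes LV :: "'v \<Rightarrow> 'a set" and LE :: "'v set \<Rightarrow> 'b set"
  assumes LV_subspace: "v \<in> V \<Longrightarrow> vs_V.subspace (LV v)"
    and LE_subspace: "e \<in> E \<Longrightarrow> vs_E.subspace (LE e)"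
    and LV_le: "v \<in> V \<Longrightarrow> LV v \<subseteq> SV v"
    and LE_le: "e \<in> E \<Longrightarrow> LE e \<subseteq> SE e"
    and restr_L: "\<lbrakk>e \<in> E; v \<in> e; x \<in> LV v\<rbrakk> \<Longrightarrow> \<gamma> v e x \<in> LE e"
    and \<eta>V_L: "\<lbrakk>g \<in> carrier G; v \<in> V; x \<in> LV v\<rbrakk> \<Longrightarrow> \<eta>V g v x \<in> LV (act g v)"
    and \<eta>E_L: "\<lbrakk>g \<in> carrier G; e \<in> E; t \<in> LE e\<rbrakk> \<Longrightarrow> \<eta>E g e t \<in> LE (act g ` e)"
    and no_section: "\<lbrakk>f \<in> H; \<And>v. v \<in> V \<Longrightarrow> f v \<in> LV v\<rbrakk> \<Longrightarrow> f = 0"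
    and lift: "\<lbrakk>f \<in> C0; \<And>e. e \<in> E \<Longrightarrow> d f e \<in> LE e\<rbrakk> \<Longrightarrow> \<exists>h\<in>H. \<forall>v\<in>V. f v - h v \<in> LV v"

lemma (in oriented_sheaf) zero_acyclic:
  "acyclic_subsheaf V E G act sV sE SV SE \<gamma> \<eta>V \<eta>E src tgt (\<lambda>_. {0}) (\<lambda>_. {0})"
proof unfold_locales
  show "vs_V.subspace {0}" by (rule vs_V.subspace_single_0)
  show "vs_E.subspace {0}" by (rule vs_E.subspace_single_0)
  show "{0} \<subseteq> SV v" if "v \<in> V" for v using vs_V.subspace_0[OF stalk_V[OF that]] by simp
  show "{0} \<subseteq> SE e" if "e \<in> E" for e using vs_E.subspace_0[OF stalk_E[OF that]] by simp
  show "\<gamma> v e x \<in> {0}" if "e \<in> E" "v \<in> e" "x \<in> {0}" for e v x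
    using gamma_zero[OF that(1,2)] that(3) by simp
  show "\<eta>V g v x \<in> {0}" if "g \<in> carrier G" "v \<in> V" "x \<in> {0}" for g v x
    using eta_zero[OF that(1,2)] that(3) by simp
  show "\<eta>E g e t \<in> {0}" if "g \<in> carrier G" "e \<in> E" "t \<in> {0}" for g e t
    using \<eta>E_diff[OF that(1,2), of 0 0] vs_E.subspace_0[OF stalk_E[OF that(2)]] that(3) by simp
  show "f = 0" if "f \<in> H" "\<And>v. v \<in> V \<Longrightarrow> f v \<in> {0}" for f
    using that(2) H_C0[OF that(1)] by (auto simp: cochains0_def fun_eq_iff)
  show "\<exists>h\<in>H. \<forall>v\<in>V. f v - h v \<in> {0}" if f: "f \<in> C0" and df: "\<And>e. e \<in> E \<Longrightarrow> d f e \<in> {0}" for f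
  proof -
    have "\<gamma> u e (f u) = \<gamma> w e (f w)" if e: "e \<in> E" "u \<in> e" "w \<in> e" for e u w
    proof -
      have "\<gamma> (src e) e (f (src e)) = \<gamma> (tgt e) e (f (tgt e))"
        using d_eq[OF f e(1)] df[OF e(1)] by simp
      moreover have "u \<in> {src e, tgt e}" "w \<in> {src e, tgt e}" using ends(1)[OF e(1)] e by blast+
      ultimately show ?thesis by auto
    qed
    then have "f \<in> H" using f H_iff by blast
    then show ?thesis by auto
  qed
qed

context acyclic_subsheaf
begin

subsection \<open>Sections supported at a vertex or on an edge\<close>

text \<open>
  Sections whose image in the quotient sheaf is supported on \<open>A\<close>. For \<open>A = {v}\<close> and for
  an edge \<open>A\<close> these are the candidates for inducing representations.
\<close>

definition supported_on :: "'v set \<Rightarrow> ('v \<Rightarrow> 'a) set" where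
  "supported_on A = {f \<in> H. \<forall>v\<in>V. v \<notin> A \<longrightarrow> f v \<in> LV v}"

text \<open>
  The germs that a section of the quotient sheaf can have at a leaf \<open>v\<close> of its support
  attached by \<open>e\<close>: across every other edge at \<open>v\<close> the section is zero, so the restriction vanishes.
\<close>

definition leaf_part :: "'v \<Rightarrow> 'v set \<Rightarrow> 'a set" where
  "leaf_part v e = {x \<in> SV v. \<forall>e'\<in>E. v \<in> e' \<and> e' \<noteq> e \<longrightarrow> \<gamma> v e' x \<in> LE e'}"

lemma supported_on_subspace: "cochain.subspace (supported_on A)"
  using H_subspace LV_subspace unfolding supported_on_def cochain.subspace_def
  by (auto simp: vs_V.subspace_0 vs_V.subspace_add vs_V.subspace_scale pw_scale_def)

lemma supported_on_act:
  assumes g: "g \<in> carrier G" and f: "f \<in> supported_on A"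
  shows "\<rho> g f \<in> supported_on (act g ` A)"
proof -
  have "\<rho> g f \<in> H"
    using f linear_rep.linear[OF H_rep g] by (auto simp: supported_on_def linear_on_def)
  moreover have "\<rho> g f v \<in> LV v" if v: "v \<in> V" "v \<notin> act g ` A" for v
  proof -
    have "act (inv g) v \<notin> A" using v act_inv2[OF g] by force
    then have "f (act (inv g) v) \<in> LV (act (inv g) v)"
      using f v actV g by (auto simp: supported_on_def)
    then show ?thesis
      using \<eta>V_L[OF g, of "act (inv g) v"] act_inv2[OF g] v actV g
      by (simp add: cochain_act_def Let_def)
  qed
  ultimately show ?thesis by (simp add: supported_on_def)
qed

text \<open>
  The restrictions of a section from the two ends of \<open>e\<close> agree, and the end outside \<open>A\<close> gives an element of \<open>L\<close>.
\<close>

lemma supported_on_restrict: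
  assumes f: "f \<in> supported_on A" and e: "e \<in> E" "u \<in> e" and z: "z \<in> e" "z \<notin> A"
  shows "\<gamma> u e (f u) \<in> LE e"
proof -
  have "\<gamma> u e (f u) = \<gamma> z e (f z)" using H_compatible[OF _ e z(1)] f by (simp add: supported_on_def)
  moreover have "f z \<in> LV z" using f z vertex_of_edge[OF e(1)] by (simp add: supported_on_def)
  ultimately show ?thesis using restr_L[OF e(1) z(1)] by simp
qed

lemma leaf_part_subspace:
  assumes "e \<in> E" "v \<in> e"
  shows "vs_V.subspace (leaf_part v e)"
proof -
  have v: "v \<in> V" using assms vertex_of_edge by blast
  show ?thesis
    unfolding vs_V.subspace_def leaf_part_def
    using stalk_V[OF v] LE_subspace
    by (auto simp: vs_V.subspace_0 vs_V.subspace_add vs_V.subspace_scale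
        vs_E.subspace_0 vs_E.subspace_add vs_E.subspace_scale gamma_zero gamma_add gamma_scale)
qed

lemma leaf_part_le: "leaf_part v e \<subseteq> SV v"
  by (auto simp: leaf_part_def)

lemma leaf_part_act:
  assumes g: "g \<in> carrier G" and e: "e \<in> E" "v \<in> e" and x: "x \<in> leaf_part v e"
  shows "\<eta>V g v x \<in> leaf_part (act g v) (act g ` e)"
proof -
  have v: "v \<in> V" using e vertex_of_edge by blast
  have "\<gamma> (act g v) e' (\<eta>V g v x) \<in> LE e'"
    if e': "e' \<in> E" "act g v \<in> e'" "e' \<noteq> act g ` e" for e'
  proof -
    let ?e = "act (inv g) ` e'"
    have E: "?e \<in> E" using e' g edge_closed by simp
    have ve: "v \<in> ?e" using e'(2) act_inv1[OF g v] by force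
    have ge: "act g ` ?e = e'" using edge_act_inv[OF g e'(1)] by simp
    then have "?e \<noteq> e" using e'(3) by auto
    then have "\<gamma> v ?e x \<in> LE ?e" using x E ve by (simp add: leaf_part_def)
    then have "\<eta>E g ?e (\<gamma> v ?e x) \<in> LE e'" using \<eta>E_L[OF g E] ge by metis
    moreover have "x \<in> SV v" using x leaf_part_le by blast
    ultimately show ?thesis using equivariant[OF g E ve] ge by simp
  qed
  moreover have "\<eta>V g v x \<in> SV (act g v)"
    using \<eta>V_linear[OF g v] x by (auto simp: linear_on_def leaf_part_def)
  ultimately show ?thesis by (simp add: leaf_part_def)
qed

lemma lift_supported:
  assumes f: "f \<in> C0" and df: "\<And>e. e \<in> E \<Longrightarrow> d f e \<in> LE e"
    and A: "\<And>v. v \<in> V \<Longrightarrow> v \<notin> A \<Longrightarrow> f v = 0"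
  shows "\<exists>h\<in>supported_on A. \<forall>v\<in>V. f v - h v \<in> LV v"
proof -
  obtain h where h: "h \<in> H" "\<And>v. v \<in> V \<Longrightarrow> f v - h v \<in> LV v" using lift[OF f df] by blast
  have "h v \<in> LV v" if "v \<in> V" "v \<notin> A" for v
    using vs_V.subspace_neg[OF LV_subspace[OF that(1)] h(2)[OF that(1)]] A[OF that] by simp
  then show ?thesis using h by (auto simp: supported_on_def)
qed

text \<open>
  A germ at \<open>v\<close> with vanishing restrictions modulo \<open>L\<close> lifts to a section supported at \<open>v\<close>.
\<close>

lemma supported_at_vertex:
  assumes v: "v \<in> V" and x: "x \<in> SV v" and dx: "\<And>e. e \<in> E \<Longrightarrow> v \<in> e \<Longrightarrow> \<gamma> v e x \<in> LE e"
    and trivial: "supported_on {v} = {0}"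
  shows "x \<in> LV v"
proof -
  let ?f = "\<lambda>w. if w = v then x else 0"
  have f: "?f \<in> C0" using v x vs_V.subspace_0[OF stalk_V] by (auto simp: cochains0_def)
  have "\<gamma> u e (?f u) \<in> LE e" if "e \<in> E" "u \<in> e" for u e
    using that dx gamma_zero vs_E.subspace_0[OF LE_subspace] by auto
  then have "d ?f e \<in> LE e" if "e \<in> E" for e
    using that d_eq[OF f that] ends(3,4)[OF that] vs_E.subspace_diff[OF LE_subspace] by metis
  then have "\<exists>h\<in>supported_on {v}. \<forall>w\<in>V. ?f w - h w \<in> LV w"
    by (intro lift_supported f) auto
  then show ?thesis using trivial v by force
qed

definition edge_cochain :: "'v set \<Rightarrow> 'a \<Rightarrow> 'a \<Rightarrow> 'v \<Rightarrow> 'a" where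
  "edge_cochain e a b = (\<lambda>v. if v = src e then a else if v = tgt e then b else 0)"

lemma edge_cochain:
  assumes e: "e \<in> E" and a: "a \<in> leaf_part (src e) e" and b: "b \<in> leaf_part (tgt e) e"
  shows "edge_cochain e a b \<in> C0"
    and "d (edge_cochain e a b) e = \<gamma> (src e) e a - \<gamma> (tgt e) e b"
    and "\<lbrakk>e' \<in> E; e' \<noteq> e\<rbrakk> \<Longrightarrow> d (edge_cochain e a b) e' \<in> LE e'"
proof -
  let ?f = "edge_cochain e a b"
  have "{v. ?f v \<noteq> 0} \<subseteq> {src e, tgt e}" by (auto simp: edge_cochain_def)
  then have "finite {v. ?f v \<noteq> 0}" by (rule finite_subset) simp
  then show f: "?f \<in> C0"
    using a b leaf_part_le ends(5,6)[OF e] vs_V.subspace_0[OF stalk_V]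
    by (auto simp: cochains0_def edge_cochain_def)
  show "d ?f e = \<gamma> (src e) e a - \<gamma> (tgt e) e b"
    using d_eq[OF f e] ends(2)[OF e] by (simp add: edge_cochain_def)
  assume e': "e' \<in> E" "e' \<noteq> e"
  have "\<gamma> u e' (?f u) \<in> LE e'" if "u \<in> e'" for u
    using that a b e' gamma_zero vs_E.subspace_0[OF LE_subspace]
    by (auto simp: edge_cochain_def leaf_part_def)
  then show "d ?f e' \<in> LE e'"
    using d_eq[OF f e'(1)] ends(3,4)[OF e'(1)] vs_E.subspace_diff[OF LE_subspace[OF e'(1)]] by metis
qed

text \<open>
  Two leaf germs that agree on \<open>e\<close> modulo \<open>L\<close> glue to a section supported on \<open>e\<close>.
\<close>

lemma supported_at_edge:
  assumes e: "e \<in> E" and a: "a \<in> leaf_part (src e) e" and b: "b \<in> leaf_part (tgt e) e"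
    and ab: "\<gamma> (src e) e a - \<gamma> (tgt e) e b \<in> LE e"
    and trivial: "supported_on e = {0}"
  shows "a \<in> LV (src e)"
proof -
  let ?f = "edge_cochain e a b"
  have "d ?f e' \<in> LE e'" if "e' \<in> E" for e'
    using edge_cochain[OF e a b] ab that by metis
  then have "\<exists>h\<in>supported_on e. \<forall>v\<in>V. ?f v - h v \<in> LV v"
    using edge_cochain(1)[OF e a b] ends(3,4)[OF e]
    by (intro lift_supported) (auto simp: edge_cochain_def)
  then have "?f v \<in> LV v" if "v \<in> V" for v using trivial that by force
  from this[of "src e"] show ?thesis
    using ends(5)[OF e] by (simp add: edge_cochain_def)
qed

text \<open>
  If the sum vanishes, then each term agrees at its own vertex with minus the sum of the other
  terms, which lies in \<open>L\<close> there. So each term is a section of \<open>L\<close>.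
\<close>

lemma vertices_independent:
  assumes A: "finite A" "A \<subseteq> V" and c: "\<And>v. v \<in> A \<Longrightarrow> c v \<in> supported_on {v}"
    and z: "(\<Sum>v\<in>A. c v) = 0" and u: "u \<in> A"
  shows "c u = 0"
proof (rule no_section)
  show "c u \<in> H" using c[OF u] by (simp add: supported_on_def)
  fix v assume v: "v \<in> V"
  show "c u v \<in> LV v"
  proof (cases "v = u")
    case False
    then show ?thesis using c[OF u] v by (simp add: supported_on_def)
  next
    case True
    \<comment> \<open>The sections whose value at \<open>v\<close> lies in \<open>L\<close>.\<close>
    let ?R = "supported_on (V - {v})"
    have "c u + (\<Sum>w\<in>A - {u}. c w) = 0" using z A u by (simp add: sum.remove[symmetric])
    then have eq: "c u = - (\<Sum>w\<in>A - {u}. c w)" by (simp add: eq_neg_iff_add_eq_0)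
    have "(\<Sum>w\<in>A - {u}. c w) \<in> ?R"
    proof (rule cochain.subspace_sum[OF supported_on_subspace])
      fix w assume "w \<in> A - {u}"
      then show "c w \<in> ?R" using c[of w] True by (auto simp: supported_on_def)
    qed
    then have "c u \<in> ?R" unfolding eq by (rule cochain.subspace_neg[OF supported_on_subspace])
    then show ?thesis using v by (simp add: supported_on_def)
  qed
qed

text \<open>
  Every value of \<open>f\<close> restricts into \<open>L\<close> on all edges, hence lies in \<open>L\<close> when nothing is supported at vertices.
\<close>

lemma section_trivial_on_edges:
  assumes trivial: "\<And>v. v \<in> V \<Longrightarrow> supported_on {v} = {0}"
    and f: "f \<in> H" and fe: "\<And>e u. e \<in> E \<Longrightarrow> u \<in> e \<Longrightarrow> \<gamma> u e (f u) \<in> LE e"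
  shows "f = 0"
  by (rule no_section[OF f], rule supported_at_vertex) (use H_value f fe trivial in auto)

text \<open>
  A section supported on an edge restricts into \<open>L\<close> on every other edge, since two edges
  share at most one vertex. In a vanishing sum each term therefore restricts into \<open>L\<close> on its own edge
  as well.
\<close>

lemma edges_independent:
  assumes trivial: "\<And>v. v \<in> V \<Longrightarrow> supported_on {v} = {0}"
    and A: "finite A" "A \<subseteq> E" and c: "\<And>e. e \<in> A \<Longrightarrow> c e \<in> supported_on e"
    and z: "(\<Sum>e\<in>A. c e) = 0" and e: "e \<in> A"
  shows "c e = 0"
proof (rule section_trivial_on_edges[OF trivial])
  show "c e \<in> H" using c[OF e] by (simp add: supported_on_def)
  fix e' u assume e': "e' \<in> E" "u \<in> e'"
  show "\<gamma> u e' (c e u) \<in> LE e'"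
  proof (cases "e' = e")
    case False
    then obtain z where "z \<in> e'" "z \<notin> e" using distinct_edges_miss e' e A by (metis subset_iff)
    then show ?thesis using supported_on_restrict[OF c[OF e] e'] by blast
  next
    case True
    let ?R = "{f \<in> H. \<gamma> u e (f u) \<in> LE e}"
    have eE: "e \<in> E" "u \<in> e" using True e' by auto
    have R: "cochain.subspace ?R"
      using H_subspace LE_subspace[OF eE(1)] vertex_of_edge[OF eE] eE
      unfolding cochain.subspace_def
      by (auto simp: gamma_zero vs_E.subspace_0 gamma_add H_value vs_E.subspace_add pw_scale_def
          gamma_scale vs_E.subspace_scale)
    have "c e + (\<Sum>w\<in>A - {e}. c w) = 0" using z A e by (simp add: sum.remove[symmetric])
    then have eq: "c e = - (\<Sum>w\<in>A - {e}. c w)" by (simp add: eq_neg_iff_add_eq_0)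
    have "(\<Sum>w\<in>A - {e}. c w) \<in> ?R"
    proof (rule cochain.subspace_sum[OF R])
      fix w assume w: "w \<in> A - {e}"
      then obtain z where "z \<in> e" "z \<notin> w" using distinct_edges_miss eE A by (metis DiffE singletonI subset_iff)
      then show "c w \<in> ?R"
        using supported_on_restrict[of "c w" w e u z] c[of w] w eE by (auto simp: supported_on_def)
    qed
    then have "c e \<in> ?R" unfolding eq by (rule cochain.subspace_neg[OF R])
    then show ?thesis using True by simp
  qed
qed (use assms in auto)

subsection \<open>Enlarging an acyclic subsheaf by its leaf parts\<close>

text \<open>
  When no nonzero section is supported at \<open>v\<close>, this is the sum of \<open>LV v\<close> and of the leaf parts for all
  edges at \<open>v\<close>, because an element is then determined modulo \<open>L\<close> by its restrictions. Membership is
  expressed edge by edge to avoid handling these sums.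
\<close>

definition LV_ext :: "'v \<Rightarrow> 'a set" where
  "LV_ext v = {x \<in> SV v. \<forall>e\<in>E. v \<in> e \<longrightarrow> (\<exists>n\<in>leaf_part v e. \<gamma> v e x - \<gamma> v e n \<in> LE e)}"

definition LE_ext :: "'v set \<Rightarrow> 'b set" where
  "LE_ext e = {t \<in> SE e. \<exists>a\<in>leaf_part (src e) e. \<exists>b\<in>leaf_part (tgt e) e.
     t - (\<gamma> (src e) e a + \<gamma> (tgt e) e b) \<in> LE e}"

lemma LV_ext_subspace:
  assumes v: "v \<in> V"
  shows "vs_V.subspace (LV_ext v)"
  unfolding vs_V.subspace_def
proof (intro conjI ballI allI)
  note S = stalk_V[OF v] and N = leaf_part_subspace
  have lp: "n \<in> SV v" if "n \<in> leaf_part v e" for n e using that leaf_part_le by blast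
  show "0 \<in> LV_ext v"
    using vs_V.subspace_0[OF S] vs_V.subspace_0[OF N] vs_E.subspace_0[OF LE_subspace]
    by (force simp: LV_ext_def)
  fix x assume x: "x \<in> LV_ext v"
  {
    fix y assume y: "y \<in> LV_ext v"
    have "\<exists>n\<in>leaf_part v e. \<gamma> v e (x + y) - \<gamma> v e n \<in> LE e" if e: "e \<in> E" "v \<in> e" for e
    proof -
      obtain m where m: "m \<in> leaf_part v e" "\<gamma> v e x - \<gamma> v e m \<in> LE e"
        using x e by (auto simp: LV_ext_def)
      obtain n where n: "n \<in> leaf_part v e" "\<gamma> v e y - \<gamma> v e n \<in> LE e"
        using y e by (auto simp: LV_ext_def)
      have "\<gamma> v e (x + y) - \<gamma> v e (m + n) = (\<gamma> v e x - \<gamma> v e m) + (\<gamma> v e y - \<gamma> v e n)"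
        using x y e m n lp by (simp add: LV_ext_def gamma_add)
      then show ?thesis
        using vs_E.subspace_add[OF LE_subspace[OF e(1)] m(2) n(2)]
          vs_V.subspace_add[OF N[OF e] m(1) n(1)] by metis
    qed
    then show "x + y \<in> LV_ext v" using x y vs_V.subspace_add[OF S] by (simp add: LV_ext_def)
  }
  fix c
  have "\<exists>n\<in>leaf_part v e. \<gamma> v e (sV c x) - \<gamma> v e n \<in> LE e" if e: "e \<in> E" "v \<in> e" for e
  proof -
    obtain m where m: "m \<in> leaf_part v e" "\<gamma> v e x - \<gamma> v e m \<in> LE e"
      using x e by (auto simp: LV_ext_def)
    have "\<gamma> v e (sV c x) - \<gamma> v e (sV c m) = sE c (\<gamma> v e x - \<gamma> v e m)"
      using x e m lp by (simp add: LV_ext_def gamma_scale vs_E.scale_right_diff_distrib)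
    then show ?thesis
      using vs_E.subspace_scale[OF LE_subspace[OF e(1)] m(2)]
        vs_V.subspace_scale[OF N[OF e] m(1)] by metis
  qed
  then show "sV c x \<in> LV_ext v" using x vs_V.subspace_scale[OF S] by (simp add: LV_ext_def)
qed

lemma LE_ext_subspace:
  assumes e: "e \<in> E"
  shows "vs_E.subspace (LE_ext e)"
  unfolding vs_E.subspace_def
proof (intro conjI ballI allI)
  let ?A = "leaf_part (src e) e" and ?B = "leaf_part (tgt e) e"
  let ?m = "\<lambda>a b. \<gamma> (src e) e a + \<gamma> (tgt e) e b"
  note S = stalk_E[OF e] and L = LE_subspace[OF e]
  note A = leaf_part_subspace[OF e ends(3)[OF e]] and B = leaf_part_subspace[OF e ends(4)[OF e]]
  have lp: "n \<in> SV v" if "n \<in> leaf_part v e" for n v using that leaf_part_le by blast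
  note lin = gamma_add[OF e] gamma_scale[OF e] lp ends(3,4)[OF e]
  have "0 - ?m 0 0 \<in> LE e" using gamma_zero[OF e] ends(3,4)[OF e] vs_E.subspace_0[OF L] by simp
  then show "0 \<in> LE_ext e"
    using vs_E.subspace_0[OF S] vs_V.subspace_0[OF A] vs_V.subspace_0[OF B]
    unfolding LE_ext_def by blast
  fix x assume "x \<in> LE_ext e"
  then obtain a b where x: "x \<in> SE e" "a \<in> ?A" "b \<in> ?B" "x - ?m a b \<in> LE e"
    by (auto simp: LE_ext_def)
  {
    fix y assume "y \<in> LE_ext e"
    then obtain a' b' where y: "y \<in> SE e" "a' \<in> ?A" "b' \<in> ?B" "y - ?m a' b' \<in> LE e"
      by (auto simp: LE_ext_def)
    have eq: "(x + y) - ?m (a + a') (b + b') = (x - ?m a b) + (y - ?m a' b')"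
      using x y lin by simp
    have "(x + y) - ?m (a + a') (b + b') \<in> LE e"
      unfolding eq by (rule vs_E.subspace_add[OF L x(4) y(4)])
    then show "x + y \<in> LE_ext e"
      using vs_E.subspace_add[OF S x(1) y(1)] vs_V.subspace_add[OF A x(2) y(2)]
        vs_V.subspace_add[OF B x(3) y(3)] unfolding LE_ext_def by blast
  }
  fix c
  have eq: "sE c x - ?m (sV c a) (sV c b) = sE c (x - ?m a b)"
    using x lin by (simp add: vs_E.scale_right_diff_distrib vs_E.scale_right_distrib)
  have "sE c x - ?m (sV c a) (sV c b) \<in> LE e"
    unfolding eq by (rule vs_E.subspace_scale[OF L x(4)])
  then show "sE c x \<in> LE_ext e"
    using vs_E.subspace_scale[OF S x(1)] vs_V.subspace_scale[OF A x(2)]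
      vs_V.subspace_scale[OF B x(3)] unfolding LE_ext_def by blast
qed

text \<open>
  The stalk on an edge does not depend on the orientation.
\<close>

lemma LE_extI:
  assumes e: "e \<in> E" "e = {u, w}" and t: "t \<in> SE e"
    and ab: "a \<in> leaf_part u e" "b \<in> leaf_part w e" "t - (\<gamma> u e a + \<gamma> w e b) \<in> LE e"
  shows "t \<in> LE_ext e"
proof -
  have "(u = src e \<and> w = tgt e) \<or> (u = tgt e \<and> w = src e)"
    using ends(1)[OF e(1)] e(2) by (metis doubleton_eq_iff)
  then show ?thesis
  proof
    assume "u = src e \<and> w = tgt e"
    then show ?thesis using t ab unfolding LE_ext_def by blast
  next
    assume "u = tgt e \<and> w = src e"
    moreover have "t - (\<gamma> w e b + \<gamma> u e a) \<in> LE e" using ab(3) by (simp add: add.commute)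
    ultimately show ?thesis using t ab(1,2) unfolding LE_ext_def by blast
  qed
qed

lemma zero_leaf_part: "e \<in> E \<Longrightarrow> v \<in> e \<Longrightarrow> 0 \<in> leaf_part v e"
  by (rule vs_V.subspace_0[OF leaf_part_subspace])

lemma leaf_part_le_ext:
  assumes e: "e \<in> E" "v \<in> e"
  shows "leaf_part v e \<subseteq> LV_ext v"
proof
  fix x assume x: "x \<in> leaf_part v e"
  have "\<exists>n\<in>leaf_part v e'. \<gamma> v e' x - \<gamma> v e' n \<in> LE e'" if e': "e' \<in> E" "v \<in> e'" for e'
  proof (cases "e' = e")
    case True
    then show ?thesis using x vs_E.subspace_0[OF LE_subspace] e by (intro bexI[of _ x]) auto
  next
    case False
    then show ?thesis using x zero_leaf_part[OF e'] gamma_zero[OF e'] e'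
      by (intro bexI[of _ 0]) (auto simp: leaf_part_def)
  qed
  then show "x \<in> LV_ext v" using x leaf_part_le by (auto simp: LV_ext_def)
qed

lemma LV_le_ext:
  assumes v: "v \<in> V"
  shows "LV v \<subseteq> LV_ext v"
proof
  fix x assume x: "x \<in> LV v"
  have "\<exists>n\<in>leaf_part v e. \<gamma> v e x - \<gamma> v e n \<in> LE e" if e: "e \<in> E" "v \<in> e" for e
    using restr_L[OF e x] zero_leaf_part[OF e] gamma_zero[OF e] by (intro bexI[of _ 0]) auto
  then show "x \<in> LV_ext v" using x LV_le[OF v] by (auto simp: LV_ext_def)
qed

lemma restr_ext:
  assumes e: "e \<in> E" "v \<in> e" and x: "x \<in> LV_ext v"
  shows "\<gamma> v e x \<in> LE_ext e"
proof -
  obtain w where w: "e = {v, w}" 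
    using ends(1)[OF e(1)] e(2) by (metis insert_commute insertE singletonD)
  then have "w \<in> e" by auto
  obtain n where "n \<in> leaf_part v e" "\<gamma> v e x - \<gamma> v e n \<in> LE e" using x e by (auto simp: LV_ext_def)
  then show ?thesis
    using LE_extI[OF e(1) w gamma_in[OF e], of x n 0] x zero_leaf_part[OF e(1) \<open>w \<in> e\<close>]
      gamma_zero[OF e(1) \<open>w \<in> e\<close>] by (simp add: LV_ext_def)
qed

lemma \<eta>V_ext:
  assumes g: "g \<in> carrier G" and v: "v \<in> V" and x: "x \<in> LV_ext v"
  shows "\<eta>V g v x \<in> LV_ext (act g v)"
proof -
  have xS: "x \<in> SV v" using x by (simp add: LV_ext_def)
  have "\<exists>n\<in>leaf_part (act g v) e. \<gamma> (act g v) e (\<eta>V g v x) - \<gamma> (act g v) e n \<in> LE e"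
    if e: "e \<in> E" "act g v \<in> e" for e
  proof -
    let ?e = "act (inv g) ` e"
    have E: "?e \<in> E" using e g edge_closed by simp
    have ve: "v \<in> ?e" using e(2) act_inv1[OF g v] by force
    have ge: "act g ` ?e = e" using edge_act_inv[OF g e(1)] by simp
    obtain n where n: "n \<in> leaf_part v ?e" "\<gamma> v ?e x - \<gamma> v ?e n \<in> LE ?e"
      using x E ve by (auto simp: LV_ext_def)
    have nS: "n \<in> SV v" using n leaf_part_le by blast
    have "\<gamma> (act g v) e (\<eta>V g v x) - \<gamma> (act g v) e (\<eta>V g v n)
        = \<eta>E g ?e (\<gamma> v ?e x) - \<eta>E g ?e (\<gamma> v ?e n)"
      using equivariant[OF g E ve] xS nS ge by simp
    also have "\<dots> = \<eta>E g ?e (\<gamma> v ?e x - \<gamma> v ?e n)"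
      using \<eta>E_diff[OF g E] gamma_in[OF E ve] xS nS by simp
    also have "\<dots> \<in> LE e" using \<eta>E_L[OF g E n(2)] ge by simp
    finally show ?thesis using leaf_part_act[OF g E ve n(1)] ge by (metis (no_types, lifting))
  qed
  moreover have "\<eta>V g v x \<in> SV (act g v)" using \<eta>V_linear[OF g v] xS by (auto simp: linear_on_def)
  ultimately show ?thesis by (simp add: LV_ext_def)
qed

lemma \<eta>E_ext:
  assumes g: "g \<in> carrier G" and e: "e \<in> E" and t: "t \<in> LE_ext e"
  shows "\<eta>E g e t \<in> LE_ext (act g ` e)"
proof -
  obtain a b where a: "a \<in> leaf_part (src e) e" and b: "b \<in> leaf_part (tgt e) e"
    and ab: "t - (\<gamma> (src e) e a + \<gamma> (tgt e) e b) \<in> LE e" and tS: "t \<in> SE e"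
    using t by (auto simp: LE_ext_def)
  note s = ends(3)[OF e] and r = ends(4)[OF e]
  have S: "a \<in> SV (src e)" "b \<in> SV (tgt e)" using a b leaf_part_le by blast+
  note m = gamma_in[OF e s S(1)] gamma_in[OF e r S(2)]
  let ?c = "\<gamma> (act g (src e)) (act g ` e) (\<eta>V g (src e) a)
    + \<gamma> (act g (tgt e)) (act g ` e) (\<eta>V g (tgt e) b)"
  have "\<eta>E g e t - ?c = \<eta>E g e (t - (\<gamma> (src e) e a + \<gamma> (tgt e) e b))"
    using equivariant[OF g e s S(1)] equivariant[OF g e r S(2)] \<eta>E_diff[OF g e tS]
      vs_E.subspace_add[OF stalk_E[OF e] m] \<eta>E_add[OF g e m] by simp
  then have "\<eta>E g e t - ?c \<in> LE (act g ` e)" using \<eta>E_L[OF g e ab] by simp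
  moreover have "act g ` e = {act g (src e), act g (tgt e)}"
    using arg_cong[OF ends(1)[OF e], of "\<lambda>e. act g ` e"] by simp
  moreover have "\<eta>E g e t \<in> SE (act g ` e)" using \<eta>E_linear[OF g e] tS by (auto simp: linear_on_def)
  ultimately show ?thesis
    using LE_extI[OF edge_closed[OF g e]] leaf_part_act[OF g e s a] leaf_part_act[OF g e r b] by blast
qed

text \<open>
  By induction on the number of edges where the differential of \<open>f\<close> is not in \<open>L\<close>: on one such
  edge it is corrected by leaf germs at the two ends, and these do not disturb any other edge.
\<close>

lemma lift_ext:
  assumes "f \<in> C0" "\<And>e. e \<in> E \<Longrightarrow> d f e \<in> LE_ext e"
  shows "\<exists>h\<in>H. \<forall>v\<in>V. f v - h v \<in> LV_ext v"
  using assms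
proof (induction "card {e \<in> E. d f e \<notin> LE e}" arbitrary: f rule: less_induct)
  case less
  note f = less.prems(1)
  have fin: "finite {e \<in> E. d f e \<notin> LE e}"
    by (rule finite_subset[OF _ d_finite[OF f]]) (use vs_E.subspace_0[OF LE_subspace] in auto)
  show ?case
  proof (cases "\<exists>e\<in>E. d f e \<notin> LE e")
    case False
    then show ?thesis using lift[OF f] LV_le_ext by blast
  next
    case True
    then obtain e where e: "e \<in> E" "d f e \<notin> LE e" by blast
    obtain a b where a: "a \<in> leaf_part (src e) e" and b: "b \<in> leaf_part (tgt e) e"
      and ab: "d f e - (\<gamma> (src e) e a + \<gamma> (tgt e) e b) \<in> LE e"
      using less.prems(2)[OF e(1)] by (auto simp: LE_ext_def)
    have bS: "b \<in> SV (tgt e)" using b leaf_part_le by blast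
    \<comment> \<open>The differential subtracts the restriction at \<open>tgt e\<close>, while the edge stalk is a sum: hence the sign.\<close>
    have b': "- b \<in> leaf_part (tgt e) e"
      by (rule vs_V.subspace_neg[OF leaf_part_subspace[OF e(1) ends(4)[OF e(1)]] b])
    let ?c = "edge_cochain e a (- b)"
    note c = edge_cochain[OF e(1) a b']
    have fc: "f - ?c \<in> C0" by (rule C0_diff[OF f c(1)])
    have dfc: "d (f - ?c) e' = d f e' - d ?c e'" if "e' \<in> E" for e'
      by (rule d_diff[OF f c(1) that])
    have cM: "?c v \<in> LV_ext v" if "v \<in> V" for v
      using a b' leaf_part_le_ext[OF e(1)] ends(3,4)[OF e(1)] vs_V.subspace_0[OF LV_ext_subspace[OF that]]
      by (auto simp: edge_cochain_def)
    have at_e: "d (f - ?c) e \<in> LE e"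
      using dfc[OF e(1)] c(2) ab gamma_minus[OF e(1) ends(4)[OF e(1)] bS] by simp
    have off_e: "d (f - ?c) e' \<in> LE e' \<longleftrightarrow> d f e' \<in> LE e'" if "e' \<in> E" "e' \<noteq> e" for e'
      using dfc[OF that(1)] c(3)[OF that] vs_E.subspace_diff[OF LE_subspace[OF that(1)]]
        vs_E.subspace_add[OF LE_subspace[OF that(1)]] by (metis diff_add_cancel)
    have "{e \<in> E. d (f - ?c) e \<notin> LE e} \<subset> {e \<in> E. d f e \<notin> LE e}"
      using at_e off_e e by blast
    then have "card {e \<in> E. d (f - ?c) e \<notin> LE e} < card {e \<in> E. d f e \<notin> LE e}"
      by (rule psubset_card_mono[OF fin])
    moreover have "d (f - ?c) e' \<in> LE_ext e'" if "e' \<in> E" for e'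
    proof -
      have "d ?c e' \<in> LE_ext e'"
        using d_eq[OF c(1) that] ends(3-6)[OF that] cM restr_ext[OF that]
          vs_E.subspace_diff[OF LE_ext_subspace[OF that]] by metis
      then show ?thesis
        using dfc[OF that] vs_E.subspace_diff[OF LE_ext_subspace[OF that] less.prems(2)[OF that]] by simp
    qed
    ultimately obtain h where h: "h \<in> H" "\<forall>v\<in>V. (f - ?c) v - h v \<in> LV_ext v"
      using less.hyps[OF _ fc] by blast
    have "f v - h v \<in> LV_ext v" if v: "v \<in> V" for v
    proof -
      have "((f - ?c) v - h v) + ?c v \<in> LV_ext v"
        using h(2) v cM vs_V.subspace_add[OF LV_ext_subspace[OF v]] by blast
      then show ?thesis by simp
    qed
    then show ?thesis using h(1) by blast
  qed
qed

text \<open>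
  Let \<open>f\<close> be a section with values in the enlarged stalks. On each edge its values at the two ends can
  be replaced by leaf germs, which agree modulo \<open>L\<close> because \<open>f\<close> is a section; as no
  section is supported on the edge, the germs lie in \<open>L\<close>. So \<open>f\<close> restricts into \<open>L\<close> on every edge.
\<close>

lemma ext_acyclic:
  assumes vertices: "\<And>v. v \<in> V \<Longrightarrow> supported_on {v} = {0}"
    and edges: "\<And>e. e \<in> E \<Longrightarrow> supported_on e = {0}"
  shows "acyclic_subsheaf V E G act sV sE SV SE \<gamma> \<eta>V \<eta>E src tgt LV_ext LE_ext"
proof unfold_locales
  show "f = 0" if f: "f \<in> H" and fM: "\<And>v. v \<in> V \<Longrightarrow> f v \<in> LV_ext v" for f
  proof (rule section_trivial_on_edges[OF vertices f])
    fix e u assume e: "e \<in> E" "u \<in> e"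
    note s = ends(3)[OF e(1)] and r = ends(4)[OF e(1)]
    obtain a where a: "a \<in> leaf_part (src e) e"
        "\<gamma> (src e) e (f (src e)) - \<gamma> (src e) e a \<in> LE e"
      using fM[OF ends(5)[OF e(1)]] e(1) s by (auto simp: LV_ext_def)
    obtain b where b: "b \<in> leaf_part (tgt e) e"
        "\<gamma> (tgt e) e (f (tgt e)) - \<gamma> (tgt e) e b \<in> LE e"
      using fM[OF ends(6)[OF e(1)]] e(1) r by (auto simp: LV_ext_def)
    have "\<gamma> (src e) e a - \<gamma> (tgt e) e b \<in> LE e"
      using vs_E.subspace_diff[OF LE_subspace[OF e(1)] b(2) a(2)] H_compatible[OF f e(1) s r]
      by simp
    then have "a \<in> LV (src e)" using supported_at_edge[OF e(1) a(1) b(1)] edges e(1) by blast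
    then have "\<gamma> (src e) e a \<in> LE e" using restr_L[OF e(1) s] by blast
    then have "\<gamma> (src e) e (f (src e)) \<in> LE e"
      using vs_E.subspace_add[OF LE_subspace[OF e(1)] a(2)] by fastforce
    then show "\<gamma> u e (f u) \<in> LE e" using H_compatible[OF f e s] by simp
  qed
  show "\<exists>h\<in>H. \<forall>v\<in>V. f v - h v \<in> LV_ext v" if "f \<in> C0" "\<And>e. e \<in> E \<Longrightarrow> d f e \<in> LE_ext e" for f
    using lift_ext that by blast
qed (use LV_ext_subspace LE_ext_subspace restr_ext \<eta>V_ext \<eta>E_ext in \<open>auto simp: LV_ext_def LE_ext_def\<close>)

text \<open>
  At a leaf \<open>u\<close> of the support of \<open>f\<close> modulo \<open>L\<close>, the restrictions of \<open>f u\<close> to all but the one edge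
  that stays inside the support lie in \<open>L\<close>.
\<close>

lemma leaf_in_ext:
  assumes f: "f \<in> H" "f \<noteq> 0"
  obtains u where "u \<in> V" "f u \<in> LV_ext u" "f u \<notin> LV u"
proof -
  let ?F = "{v \<in> V. f v \<notin> LV v}"
  have fin: "finite ?F"
    by (rule finite_subset[of _ "{v. f v \<noteq> 0}"])
      (use H_C0[OF f(1)] vs_V.subspace_0[OF LV_subspace] in \<open>auto simp: cochains0_def\<close>)
  have ne: "?F \<noteq> {}" using no_section f by blast
  obtain u where u: "u \<in> ?F"
    and leaf: "\<forall>e\<in>E. \<forall>e'\<in>E. u \<in> e \<and> u \<in> e' \<and> e \<subseteq> ?F \<and> e' \<subseteq> ?F \<longrightarrow> e = e'"
    by (rule obtain_leaf[OF fin ne])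
  have outer: "\<gamma> u e (f u) \<in> LE e" if e: "e \<in> E" "u \<in> e" "\<not> e \<subseteq> ?F" for e
  proof -
    obtain z where "z \<in> e" "z \<notin> ?F" using e by blast
    then show ?thesis
      using supported_on_restrict[of f ?F e u z] f e by (auto simp: supported_on_def)
  qed
  have fu: "f u \<in> SV u" using H_value[OF f(1)] u by simp
  have "\<exists>n\<in>leaf_part u e. \<gamma> u e (f u) - \<gamma> u e n \<in> LE e" if e: "e \<in> E" "u \<in> e" for e
  proof (cases "e \<subseteq> ?F")
    case True
    have "\<gamma> u e' (f u) \<in> LE e'" if e': "e' \<in> E" "u \<in> e'" "e' \<noteq> e" for e'
    proof (rule outer[OF e'(1,2)])
      show "\<not> e' \<subseteq> ?F" using leaf e e' True by blast
    qed
    then have "f u \<in> leaf_part u e" using fu by (simp add: leaf_part_def)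
    then show ?thesis using vs_E.subspace_0[OF LE_subspace] e by (intro bexI[of _ "f u"]) auto
  next
    case False
    then show ?thesis using outer e zero_leaf_part[OF e] gamma_zero[OF e]
      by (intro bexI[of _ 0]) auto
  qed
  then have "f u \<in> LV_ext u" using fu by (simp add: LV_ext_def)
  then show ?thesis using that u by blast
qed

lemma support_mod_ext_less:
  assumes f: "f \<in> H" "f \<noteq> 0"
  shows "card {v \<in> V. f v \<notin> LV_ext v} < card {v \<in> V. f v \<notin> LV v}"
proof (rule psubset_card_mono)
  show "finite {v \<in> V. f v \<notin> LV v}"
    by (rule finite_subset[of _ "{v. f v \<noteq> 0}"])
      (use H_C0[OF f(1)] vs_V.subspace_0[OF LV_subspace] in \<open>auto simp: cochains0_def\<close>)
  show "{v \<in> V. f v \<notin> LV_ext v} \<subset> {v \<in> V. f v \<notin> LV v}"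
  proof (rule psubsetI)
    show "{v \<in> V. f v \<notin> LV_ext v} \<subseteq> {v \<in> V. f v \<notin> LV v}" using LV_le_ext by blast
    obtain u where "u \<in> V" "f u \<in> LV_ext u" "f u \<notin> LV u" by (rule leaf_in_ext[OF f])
    then show "{v \<in> V. f v \<notin> LV_ext v} \<noteq> {v \<in> V. f v \<notin> LV v}" by blast
  qed
qed

subsection \<open>Systems of imprimitivity on the space of sections\<close>

lemma vertex_imprimitivity:
  "imprimitivity_system G (pw_scale sV) H \<rho> V act (\<lambda>v. supported_on {v})"
proof -
  interpret linear_rep G "pw_scale sV" H \<rho> by (rule H_rep)
  show ?thesis
  proof unfold_locales
    show "c j = 0" if "finite A" "A \<subseteq> V" "\<And>i. i \<in> A \<Longrightarrow> c i \<in> supported_on {i}"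
      "(\<Sum>i\<in>A. c i) = 0" "j \<in> A" for A c j
      using vertices_independent that by blast
    show "\<rho> g x \<in> supported_on {act g i}" if "g \<in> carrier G" "x \<in> supported_on {i}" for g i x
      using supported_on_act[OF that] by simp
    show "cochain.subspace (supported_on {i})" for i by (rule supported_on_subspace)
  qed (use actV act_one act_mult in \<open>auto simp: supported_on_def\<close>)
qed

lemma edge_imprimitivity:
  assumes trivial: "\<And>v. v \<in> V \<Longrightarrow> supported_on {v} = {0}"
  shows "imprimitivity_system G (pw_scale sV) H \<rho> E (\<lambda>g e. act g ` e) supported_on"
proof -
  interpret linear_rep G "pw_scale sV" H \<rho> by (rule H_rep)
  show ?thesis
  proof unfold_locales
    show "c j = 0" if "finite A" "A \<subseteq> E" "\<And>i. i \<in> A \<Longrightarrow> c i \<in> supported_on i"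
      "(\<Sum>i\<in>A. c i) = 0" "j \<in> A" for A c j
      using edges_independent[OF trivial] that by blast
    show "act \<one> ` e = e" if "e \<in> E" for e
      using act_one vertex_of_edge[OF that] by force
    show "act (g \<otimes> h) ` e = act g ` act h ` e"
      if "g \<in> carrier G" "h \<in> carrier G" "e \<in> E" for g h e
      using act_mult[OF that(1,2)] vertex_of_edge[OF that(3)] by (force simp: image_image)
  qed (use edge_closed supported_on_subspace supported_on_act in \<open>auto simp: supported_on_def\<close>)
qed

end

section \<open>Induction from a vertex or an edge\<close>

context oriented_sheaf
begin

abbreviation induced_from :: "'g set \<Rightarrow> bool" where
  "induced_from K \<equiv> subgroup K G \<and> (\<exists>(S :: ('v \<Rightarrow> 'a) set) \<sigma>.
      linear_rep (G\<lparr>carrier := K\<rparr>) (pw_scale sV) S \<sigma> \<and>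
      isomorphic_reps G (pw_scale sV) H \<rho> (pw_scale (pw_scale sV)) (cInd G K S \<sigma>) (left_transl G))"

text \<open>
  For a fixed nonzero section \<open>f\<close>, the acyclic subsheaf is chosen to make the support of \<open>f\<close> modulo it
  as small as possible. If there were no nonzero sections supported at a vertex or on an edge, then the
  subsheaf could be enlarged to absorb a leaf of that support.
\<close>

lemma irreducible_induced:
  assumes irr: "irreducible_rep G (pw_scale sV) H \<rho>"
  shows "(\<exists>v\<in>V. induced_from (stabilizer G act v)) \<or>
    (\<exists>e\<in>E. induced_from (stabilizer G (\<lambda>g e. act g ` e) e))"
proof -
  let ?acyclic = "acyclic_subsheaf V E G act sV sE SV SE \<gamma> \<eta>V \<eta>E src tgt"
  obtain f where f: "f \<in> H" "f \<noteq> 0"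
    using irr cochain.subspace_0[OF H_subspace] unfolding irreducible_rep_def by blast
  let ?size = "\<lambda>L. card {v \<in> V. f v \<notin> fst L v}"
  have "?acyclic (fst (\<lambda>_. {0}, \<lambda>_. {0})) (snd (\<lambda>_. {0}, \<lambda>_. {0}))"
    using zero_acyclic by simp
  from ex_has_least_nat[where P = "\<lambda>L. ?acyclic (fst L) (snd L)" and m = ?size, OF this]
  obtain L where L: "?acyclic (fst L) (snd L)"
    and least: "\<And>M. ?acyclic (fst M) (snd M) \<Longrightarrow> ?size L \<le> ?size M"
    by blast
  interpret L: acyclic_subsheaf V E G act sV sE SV SE \<gamma> \<eta>V \<eta>E src tgt "fst L" "snd L"
    by (rule L)
  show ?thesis
  proof (cases "\<exists>v\<in>V. L.supported_on {v} \<noteq> {0}")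
    case True
    then obtain v where v: "v \<in> V" "L.supported_on {v} \<noteq> {0}" by blast
    interpret imprimitivity_system G "pw_scale sV" H \<rho> V act "\<lambda>v. L.supported_on {v}"
      by (rule L.vertex_imprimitivity)
    show ?thesis
      using v stabilizer_is_subgroup stabilizer_rep irreducible_imp_induced[OF v(1) irr] by blast
  next
    case False
    then have vertices: "\<And>v. v \<in> V \<Longrightarrow> L.supported_on {v} = {0}" by blast
    have "\<exists>e\<in>E. L.supported_on e \<noteq> {0}"
    proof (rule ccontr)
      assume "\<not> ?thesis"
      then have "?acyclic L.LV_ext L.LE_ext" using L.ext_acyclic[OF vertices] by blast
      then show False using least[of "(L.LV_ext, L.LE_ext)"] L.support_mod_ext_less[OF f] by simp
    qed
    then obtain e where e: "e \<in> E" "L.supported_on e \<noteq> {0}" by blast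
    interpret imprimitivity_system G "pw_scale sV" H \<rho> E "\<lambda>g e. act g ` e" L.supported_on
      by (rule L.edge_imprimitivity[OF vertices])
    show ?thesis
      using e stabilizer_is_subgroup stabilizer_rep irreducible_imp_induced[OF e(1) irr] by blast
  qed
qed

lemma zero_induced:
  assumes H: "H = {0}" and v: "v \<in> V"
  shows "induced_from (stabilizer G act v)"
proof (intro conjI exI)
  let ?K = "stabilizer G act v"
  show K: "subgroup ?K G" by (rule stabilizer_subgroup[OF v])
  interpret K: group "G\<lparr>carrier := ?K\<rparr>" by (rule grp.subgroup_imp_group[OF K])
  show "linear_rep (G\<lparr>carrier := ?K\<rparr>) (pw_scale sV) ({0} :: ('v \<Rightarrow> 'a) set) (\<lambda>_ x. x)"
    by unfold_locales (auto simp: linear_on_def cochain.subspace_single_0)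
  have C: "cInd G ?K {0 :: 'v \<Rightarrow> 'a} (\<lambda>_ x. x) = {0}"
  proof -
    have "f = 0" if "f \<in> cInd G ?K {0 :: 'v \<Rightarrow> 'a} (\<lambda>_ x. x)" for f
    proof
      show "f g = 0 g" for g using that by (cases "g \<in> carrier G") (auto simp: cInd_def)
    qed
    moreover have "0 \<in> cInd G ?K {0 :: 'v \<Rightarrow> 'a} (\<lambda>_ x. x)" by (auto simp: cInd_def)
    ultimately show ?thesis by blast
  qed
  show "isomorphic_reps G (pw_scale sV) H \<rho> (pw_scale (pw_scale sV))
      (cInd G ?K {0 :: 'v \<Rightarrow> 'a} (\<lambda>_ x. x)) (left_transl G)"
    unfolding isomorphic_reps_def C H
    by (rule exI[of _ "\<lambda>_. 0"])
      (auto simp: linear_on_def bij_betw_def pw_scale_def left_transl_def fun_eq_iff)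
qed

end

theorem theorem2p4:
  fixes V :: "'v set" and E :: "'v set set"
    and G :: "('g, 'm) monoid_scheme" and act :: "'g \<Rightarrow> 'v \<Rightarrow> 'v"
    and sV :: "'k::field \<Rightarrow> 'a::ab_group_add \<Rightarrow> 'a"
    and sE :: "'k \<Rightarrow> 'b::ab_group_add \<Rightarrow> 'b"
    and SV :: "'v \<Rightarrow> 'a set" and SE :: "'v set \<Rightarrow> 'b set"
    and \<gamma> :: "'v \<Rightarrow> 'v set \<Rightarrow> 'a \<Rightarrow> 'b"
    and \<eta>V :: "'g \<Rightarrow> 'v \<Rightarrow> 'a \<Rightarrow> 'a" and \<eta>E :: "'g \<Rightarrow> 'v set \<Rightarrow> 'b \<Rightarrow> 'b"
    and src tgt :: "'v set \<Rightarrow> 'v"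
  assumes "equivariant_sheaf V E G act sV sE SV SE \<gamma> \<eta>V \<eta>E"
    and "orientation E src tgt"
    and "rank0 V G act sV SV < \<infinity>"
    and "H0c V E sE SV \<gamma> src tgt = {0} \<or>
      irreducible_rep G (pw_scale sV) (H0c V E sE SV \<gamma> src tgt) (cochain_act V G act \<eta>V)"
  shows "\<exists>K. subgroup K G \<and>
      ((\<exists>v\<in>V. K = stabilizer G act v) \<or> (\<exists>e\<in>E. K = stabilizer G (\<lambda>g e. act g ` e) e)) \<and>
      (\<exists>(S :: ('v \<Rightarrow> 'a) set) \<sigma>.
        linear_rep (G\<lparr>carrier := K\<rparr>) (pw_scale sV) S \<sigma> \<and>
        isomorphic_reps G
          (pw_scale sV) (H0c V E sE SV \<gamma> src tgt) (cochain_act V G act \<eta>V)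
          (pw_scale (pw_scale sV)) (cInd G K S \<sigma>) (left_transl G))"
proof -
  interpret oriented_sheaf V E G act sV sE SV SE \<gamma> \<eta>V \<eta>E src tgt
    using assms(1,2) by (simp add: oriented_sheaf_def oriented_sheaf_axioms_def)
  have "(\<exists>v\<in>V. induced_from (stabilizer G act v)) \<or>
      (\<exists>e\<in>E. induced_from (stabilizer G (\<lambda>g e. act g ` e) e))"
    using assms(4)
  proof
    assume "H = {0}"
    moreover obtain v where "v \<in> V" using nonempty by blast
    ultimately show ?thesis using zero_induced by (intro disjI1 bexI)
  qed (rule irreducible_induced)
  then obtain K where "induced_from K"
      "(\<exists>v\<in>V. K = stabilizer G act v) \<or> (\<exists>e\<in>E. K = stabilizer G (\<lambda>g e. act g ` e) e)"
    by blast
  then show ?thesis by (intro exI[of _ K]) simp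
qed

end
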